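(* Let $n\ge 2$ and $\mathcal{M}=\{a\in\mathbb{R}^n:\ \sum_{r=1}^n a_r^2=1,\ \sum_{r=1}^n a_r=0\}$. The function $a\in\mathcal{M}\mapsto \operatorname{vol}_{n-1}(B_1^n\cap a^\perp)$ attains its minimum over $\mathcal{M}$, when $n$ is even, at the vector $$\left(\underbrace{\tfrac{1}{\sqrt n},\dots,\tfrac1{\sqrt n}}_{n/2\text{ times}},\ \underbrace{-\tfrac{1}{\sqrt n},\dots,-\tfrac1{\sqrt n}}_{n/2\text{ times}}\right),$$ and, when $n$ is odd, at the vector $$\left(\underbrace{\sqrt{\tfrac{n+1}{n(n-1)}},\dots,\sqrt{\tfrac{n+1}{n(n-1)}}}_{\frac{n-1}{2}\text{ times}},\ \underbrace{-\sqrt{\tfrac{n-1}{n(n+1)}},\dots,-\sqrt{\tfrac{n-1}{n(n+1)}}}_{\frac{n+1}{2}\text{ times}}\right).$$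
   Context: $B_1^n=\operatorname{conv}\{\pm e_1,\dots,\pm e_n\}=\{x\in\mathbb{R}^n:\sum_{j}|x_j|\le1\}$ is the cross-polytope. $a^\perp=\{x\in\mathbb{R}^n:\langle x,a\rangle=0\}$. $\operatorname{vol}_{n-1}$ is $(n-1)$-dimensional Lebesgue (Hausdorff) measure, normalized so that unit cubes have volume $1$. *)

theory Defs
  imports "HOL-Analysis.Analysis"
begin

definition orthonormal_basis :: "'a::euclidean_space set \<Rightarrow> 'a set \<Rightarrow> bool" where
  "orthonormal_basis B V \<longleftrightarrow>
     B \<subseteq> V \<and> pairwise orthogonal B \<and> (\<forall>b\<in>B. norm b = 1) \<and> span B = V"

(* Lebesgue measure of dimension dim V on a linear subspace V: the image of the product Lebesgue
   measure on coordinates under c \<mapsto> (\<Sum>b\<in>B. c b *\<^sub>R b), exactly as lborel is built from Basis (see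
   lborel_eq).  It does not depend on the orthonormal basis B; see lborel_on_eq below. *)
definition lborel_on :: "'a::euclidean_space set \<Rightarrow> 'a measure" where
  "lborel_on V = (let B = SOME B. orthonormal_basis B V in
     distr (\<Pi>\<^sub>M b\<in>B. lborel) borel (\<lambda>c. \<Sum>b\<in>B. c b *\<^sub>R b))"

definition cross_polytope :: "(real ^ 'n) set" where
  "cross_polytope = {x. (\<Sum>j\<in>UNIV. \<bar>x $ j\<bar>) \<le> 1}"

definition hyperplane_orth :: "real ^ 'n \<Rightarrow> (real ^ 'n) set" where
  "hyperplane_orth a = {x. x \<bullet> a = 0}"

(* Extended-real valued, so that no set gets a junk volume for being unbounded. *)
definition section_volume :: "real ^ 'n \<Rightarrow> ennreal" where
  "section_volume a = emeasure (lborel_on (hyperplane_orth a)) (cross_polytope \<inter> hyperplane_orth a)"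

definition unit_zero_sum :: "(real ^ 'n) set" where
  "unit_zero_sum = {a. (\<Sum>r\<in>UNIV. (a $ r)\<^sup>2) = 1 \<and> (\<Sum>r\<in>UNIV. a $ r) = 0}"

(* The vector (c,...,c,d,...,d) with c in the first k places; the coordinates are ordered by the
   linear order of the index type, so card {j. j < i} is the 0-based position of i. *)
definition two_block :: "nat \<Rightarrow> real \<Rightarrow> real \<Rightarrow> real ^ 'n::{finite,wellorder}" where
  "two_block k c d = (\<chi> i. if card {j. j < i} < k then c else d)"


lemma orthonormal_basis_exists:
  assumes "subspace V"
  shows "\<exists>B. orthonormal_basis B V"
  using orthonormal_basis_subspace[OF assms] unfolding orthonormal_basis_def by metis

lemma orthonormal_basis_independent:
  assumes "orthonormal_basis B V"
  shows "independent B" "finite B"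
proof -
  show "independent B"
    using assms unfolding orthonormal_basis_def
    by (intro pairwise_orthogonal_independent) auto
  then show "finite B" by (rule independent_imp_finite)
qed

lemma orthonormal_basis_inner:
  assumes "orthonormal_basis B V" "b \<in> B" "b' \<in> B"
  shows "b \<bullet> b' = (if b = b' then 1 else 0)"
  using assms unfolding orthonormal_basis_def pairwise_def orthogonal_def
  by (auto simp: norm_eq_1)

lemma orthonormal_basis_coord:
  assumes "orthonormal_basis B V" "b \<in> B"
  shows "(\<Sum>b'\<in>B. c b' *\<^sub>R b') \<bullet> b = c b"
proof -
  have "(\<Sum>b'\<in>B. c b' *\<^sub>R b') \<bullet> b = (\<Sum>b'\<in>B. if b' = b then c b' else 0)"
    unfolding inner_sum_left using orthonormal_basis_inner[OF assms(1) _ assms(2)]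
    by (intro sum.cong) auto
  then show ?thesis
    using assms(2) orthonormal_basis_independent(2)[OF assms(1)] by simp
qed

lemma orthonormal_basis_measurable [measurable]:
  fixes B :: "'a::euclidean_space set"
  shows "(\<lambda>c. \<Sum>b\<in>B. c b *\<^sub>R b) \<in> borel_measurable (\<Pi>\<^sub>M b\<in>B. lborel)"
  by measurable

lemma distr_lborel_orthogonal:
  fixes f :: "real ^ 'n::{finite,wellorder} \<Rightarrow> real ^ 'n::_"
  assumes f: "orthogonal_transformation f"
  shows "distr lborel borel f = lborel"
proof (rule lborel_eqI[symmetric])
  obtain g where g: "orthogonal_transformation g" "\<And>x. g (f x) = x" "\<And>x. f (g x) = x"
    using f by (metis bij_is_inj bij_is_surj inv_f_f orthogonal_transformation_bij
        orthogonal_transformation_inv surj_f_inv_f)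
  have mf: "f \<in> borel_measurable borel"
    using f by (intro borel_measurable_continuous_onI)
      (auto simp: orthogonal_transformation_linear linear_continuous_on linear_linear)
  fix l u :: "real ^ 'n::_"
  assume le: "\<And>b. b \<in> Basis \<Longrightarrow> l \<bullet> b \<le> u \<bullet> b"
  have vimg: "f -` box l u = g ` box l u"
    using g by (auto simp: image_iff) metis
  have lm: "g ` box l u \<in> lmeasurable" and
    meas: "measure lebesgue (g ` box l u) = measure lebesgue (box l u)"
    using measurable_orthogonal_image[OF g(1), of "box l u"]
      measure_orthogonal_image[OF g(1), of "box l u"] by auto
  have sb: "g ` box l u \<in> sets borel"
    using measurable_sets[OF mf, of "box l u"] vimg by auto
  have "emeasure (distr lborel borel f) (box l u) = emeasure lebesgue (g ` box l u)"
    using mf sb by (subst emeasure_distr) (auto simp: vimg)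
  also have "\<dots> = emeasure lebesgue (box l u)"
    using lm meas by (simp add: emeasure_eq_measure2)
  also have "\<dots> = (\<Prod>b\<in>Basis. (u - l) \<bullet> b)"
    using le by (simp add: emeasure_lborel_box)
  finally show "emeasure (distr lborel borel f) (box l u) = (\<Prod>b\<in>Basis. (u - l) \<bullet> b)" .
qed simp

lemma distr_orthonormal_basis_UNIV:
  fixes E :: "(real ^ 'n::{finite,wellorder}) set"
  assumes E: "orthonormal_basis E UNIV"
  shows "distr (\<Pi>\<^sub>M b\<in>E. lborel) borel (\<lambda>c. \<Sum>b\<in>E. c b *\<^sub>R b) = lborel"
proof -
  interpret product_sigma_finite "\<lambda>_::real^'n::_. lborel :: real measure"
    by standard
  have fin: "finite E" and ind: "independent E"
    using orthonormal_basis_independent[OF E] by auto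
  have "card E = card (Basis :: (real^'n::_) set)"
    using E ind dim_eq_card_independent[OF ind] unfolding orthonormal_basis_def
    by (metis dim_UNIV dim_span)
  then obtain g where g: "bij_betw g E (Basis :: (real^'n::_) set)"
    using finite_same_card_bij[OF fin finite_Basis] by blast
  define h where "h = the_inv_into E g"
  have h: "bij_betw h Basis E" unfolding h_def by (rule bij_betw_the_inv_into[OF g])
  have hg: "h (g e) = e" if "e \<in> E" for e
    unfolding h_def using g that by (simp add: bij_betw_def the_inv_into_f_f)
  define f where "f x = (\<Sum>b\<in>Basis. (x \<bullet> b) *\<^sub>R h b)" for x :: "real^'n::_"
  have f_eq: "f x = (\<Sum>e\<in>E. (x \<bullet> g e) *\<^sub>R e)" for x
    unfolding f_def
    by (subst sum.reindex_bij_betw[OF g, symmetric]) (auto intro!: sum.cong simp: hg)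
  have "linear f"
    unfolding f_def by (intro linearI)
      (auto simp: inner_add_left scaleR_add_left sum.distrib scaleR_sum_right)
  moreover have "f x \<bullet> f y = x \<bullet> y" for x y
  proof -
    have "f x \<bullet> f y = (\<Sum>e\<in>E. (y \<bullet> g e) * (f x \<bullet> e))"
      unfolding f_eq[of y] by (simp add: inner_sum_right)
    also have "\<dots> = (\<Sum>e\<in>E. (y \<bullet> g e) * (x \<bullet> g e))"
      unfolding f_eq[of x] by (intro sum.cong refl) (simp add: orthonormal_basis_coord[OF E])
    also have "\<dots> = x \<bullet> y"
      unfolding euclidean_inner[of x y]
      by (subst sum.reindex_bij_betw[OF g]) (simp add: mult.commute)
    finally show ?thesis .
  qed
  ultimately have of: "orthogonal_transformation f"
    by (simp add: orthogonal_transformation_def)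
  have mf: "f \<in> borel_measurable borel"
    using of by (intro borel_measurable_continuous_onI)
      (auto simp: orthogonal_transformation_linear linear_continuous_on linear_linear)
  let ?k = "\<lambda>c::real^'n::_ \<Rightarrow> real. \<Sum>e\<in>E. c e *\<^sub>R g e"
  have mk: "?k \<in> measurable (\<Pi>\<^sub>M b\<in>E. lborel) borel" by measurable
  have kg: "?k c \<bullet> g e = c e" if "e \<in> E" for c e
  proof -
    have "?k c \<bullet> g e = (\<Sum>e'\<in>E. if e' = e then c e' else 0)"
    proof (unfold inner_sum_left, intro sum.cong refl)
      fix e' assume "e' \<in> E"
      then have "g e' \<in> Basis" "g e \<in> Basis" "g e' = g e \<longleftrightarrow> e' = e"
        using g that by (auto simp: bij_betw_def inj_on_def)
      then show "c e' *\<^sub>R g e' \<bullet> g e = (if e' = e then c e' else 0)"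
        by (simp add: inner_Basis)
    qed
    then show ?thesis using that fin by simp
  qed
  have "lborel = distr (\<Pi>\<^sub>M b\<in>E. lborel) borel ?k"
  proof (rule lborel_eqI)
    fix l u :: "real ^ 'n::_"
    assume le: "\<And>b. b \<in> Basis \<Longrightarrow> l \<bullet> b \<le> u \<bullet> b"
    have "?k -` box l u \<inter> space (\<Pi>\<^sub>M b\<in>E. lborel) = (\<Pi>\<^sub>E e\<in>E. {l \<bullet> g e <..< u \<bullet> g e})"
    proof -
      have "?k c \<in> box l u \<longleftrightarrow> (\<forall>e\<in>E. l \<bullet> g e < c e \<and> c e < u \<bullet> g e)" for c
      proof -
        have "?k c \<in> box l u \<longleftrightarrow> (\<forall>b\<in>g ` E. l \<bullet> b < ?k c \<bullet> b \<and> ?k c \<bullet> b < u \<bullet> b)"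
          using g by (simp add: mem_box bij_betw_def)
        then show ?thesis by (simp add: kg)
      qed
      then show ?thesis by (auto simp: space_PiM PiE_iff extensional_def)
    qed
    then have "emeasure (distr (\<Pi>\<^sub>M b\<in>E. lborel) borel ?k) (box l u) =
        (\<Prod>e\<in>E. emeasure lborel {l \<bullet> g e <..< u \<bullet> g e})"
      using fin mk by (simp add: emeasure_distr emeasure_PiM)
    also have "\<dots> = (\<Prod>e\<in>E. ennreal ((u - l) \<bullet> g e))"
    proof (intro prod.cong refl)
      fix e assume "e \<in> E"
      then have "g e \<in> Basis" using g by (auto simp: bij_betw_def)
      then show "emeasure lborel {l \<bullet> g e <..< u \<bullet> g e} = ennreal ((u - l) \<bullet> g e)"
        using le by (simp add: inner_diff_left)
    qed
    also have "\<dots> = (\<Prod>b\<in>Basis. ennreal ((u - l) \<bullet> b))"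
      by (rule prod.reindex_bij_betw[OF g])
    also have "\<dots> = ennreal (\<Prod>b\<in>Basis. (u - l) \<bullet> b)"
      using le by (intro prod_ennreal) (auto simp: inner_diff_left)
    finally show "emeasure (distr (\<Pi>\<^sub>M b\<in>E. lborel) borel ?k) (box l u) =
      (\<Prod>b\<in>Basis. (u - l) \<bullet> b)" .
  qed simp
  then have "lborel = distr (distr (\<Pi>\<^sub>M b\<in>E. lborel) borel ?k) borel f"
    using distr_lborel_orthogonal[OF of] by simp
  also have "\<dots> = distr (\<Pi>\<^sub>M b\<in>E. lborel) borel (f \<circ> ?k)"
    using mf mk by (rule distr_distr)
  also have "f \<circ> ?k = (\<lambda>c. \<Sum>e\<in>E. c e *\<^sub>R e)"
    by (rule ext) (simp add: f_eq kg)
  finally show ?thesis by simp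
qed

lemma emeasure_distr_orthonormal_basis:
  fixes V :: "(real ^ 'n::{finite,wellorder}) set"
  assumes B: "orthonormal_basis B V" and C: "orthonormal_basis C (orthogonal_comp V)"
    and A: "A \<in> sets borel"
  shows "emeasure (distr (\<Pi>\<^sub>M b\<in>B. lborel) borel (\<lambda>c. \<Sum>b\<in>B. c b *\<^sub>R b)) A =
    emeasure lborel {x. (\<Sum>b\<in>B. (x \<bullet> b) *\<^sub>R b) \<in> A \<and> (\<forall>c\<in>C. x \<bullet> c \<in> {0..1})}"
proof -
  interpret product_sigma_finite "\<lambda>_::real^'n::_. lborel :: real measure"
    by standard
  have fin: "finite B" "finite C"
    using orthonormal_basis_independent B C by auto
  have orth: "orthogonal b c" if "b \<in> V" "c \<in> orthogonal_comp V" for b c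
    using that by (auto simp: orthogonal_comp_def)
  have BV: "B \<subseteq> V" and CV: "C \<subseteq> orthogonal_comp V" and sB: "span B = V"
    and sC: "span C = orthogonal_comp V"
    using B C by (auto simp: orthonormal_basis_def)
  have n1: "\<forall>b\<in>B \<union> C. norm b = 1" using B C by (auto simp: orthonormal_basis_def)
  have disj: "B \<inter> C = {}"
    using orth BV CV n1 by (force simp: orthogonal_def)
  have span: "span (B \<union> C) = UNIV"
  proof -
    have "x \<in> span (B \<union> C)" for x
    proof -
      obtain y z where "y \<in> span V" "\<And>w. w \<in> span V \<Longrightarrow> orthogonal z w" "x = y + z"
        using orthogonal_subspace_decomp_exists[of V x] by blast
      then have "y \<in> span B" "z \<in> span C" "x = y + z"
        using sB sC by (auto simp: orthogonal_comp_def orthogonal_commute span_base span_span)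
      then show ?thesis
        by (auto intro!: span_add intro: subsetD[OF span_mono])
    qed
    then show ?thesis by auto
  qed
  have BC: "orthogonal b c" "orthogonal c b" if "b \<in> B" "c \<in> C" for b c
    using orth that BV CV orthogonal_commute by blast+
  have "pairwise orthogonal B" "pairwise orthogonal C"
    using B C by (auto simp: orthonormal_basis_def)
  then have "pairwise orthogonal (B \<union> C)"
    using BC unfolding pairwise_def by blast
  then have E: "orthonormal_basis (B \<union> C) UNIV"
    using n1 span unfolding orthonormal_basis_def by simp
  define D where "D = {x. (\<Sum>b\<in>B. (x \<bullet> b) *\<^sub>R b) \<in> A \<and> (\<forall>c\<in>C. x \<bullet> c \<in> {0..1})}"
  have D: "D \<in> sets borel"
  proof -
    have "(\<lambda>x. \<Sum>b\<in>B. (x \<bullet> b) *\<^sub>R b) -` A \<inter> space borel \<in> sets borel"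
      by (intro measurable_sets[OF _ A]) measurable
    moreover have "{x. \<forall>c\<in>C. x \<bullet> c \<in> {0..1::real}} \<in> sets borel"
    proof -
      have "closed {x. \<forall>c\<in>C. x \<bullet> c \<in> {0..1::real}}"
        unfolding Ball_def atLeastAtMost_iff
        by (intro closed_Collect_all closed_Collect_imp closed_Collect_conj closed_Collect_le
            continuous_intros) auto
      then show ?thesis by simp
    qed
    ultimately have "((\<lambda>x. \<Sum>b\<in>B. (x \<bullet> b) *\<^sub>R b) -` A \<inter> space borel) \<inter>
        {x. \<forall>c\<in>C. x \<bullet> c \<in> {0..1::real}} \<in> sets borel"
      by (rule sets.Int)
    then show ?thesis
      unfolding D_def by (simp add: vimage_def Int_def)
  qed
  let ?T = "\<lambda>c. \<Sum>b\<in>B \<union> C. c b *\<^sub>R b"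
  let ?S = "\<lambda>c. \<Sum>b\<in>B. c b *\<^sub>R b"
  let ?M = "\<lambda>I. \<Pi>\<^sub>M b\<in>I. (lborel::real measure)"
  have Tm: "merge B C (u, v) \<in> ?T -` D \<longleftrightarrow> ?S u \<in> A \<and> (\<forall>c\<in>C. v c \<in> {0..1})" for u v
  proof -
    let ?m = "merge B C (u, v)"
    have co: "?T ?m \<bullet> b = ?m b" if "b \<in> B \<union> C" for b
      using orthonormal_basis_coord[OF E that] .
    have "(\<Sum>b\<in>B. (?T ?m \<bullet> b) *\<^sub>R b) = ?S u"
      by (intro sum.cong refl, subst co) (auto simp: merge_def)
    moreover have "?T ?m \<bullet> c = v c" if "c \<in> C" for c
      using that disj by (subst co) (auto simp: merge_def)
    ultimately show ?thesis by (simp add: D_def)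
  qed
  have "emeasure lborel D = emeasure (distr (?M (B \<union> C)) borel ?T) D"
    using distr_orthonormal_basis_UNIV[OF E] by simp
  also have "\<dots> = emeasure (?M (B \<union> C)) (?T -` D \<inter> space (?M (B \<union> C)))"
    using D by (subst emeasure_distr) auto
  also have "\<dots> = (\<integral>\<^sup>+z. indicator (?T -` D \<inter> space (?M (B \<union> C))) z \<partial>?M (B \<union> C))"
    using D by (subst nn_integral_indicator) (auto intro!: measurable_sets)
  also have "\<dots> = (\<integral>\<^sup>+u. \<integral>\<^sup>+v. indicator (?T -` D \<inter> space (?M (B \<union> C))) (merge B C (u, v))
      \<partial>?M C \<partial>?M B)"
    using D disj fin
    by (intro product_nn_integral_fold borel_measurable_indicator measurable_sets) auto
  also have "\<dots> = (\<integral>\<^sup>+u. \<integral>\<^sup>+v. indicator (?S -` A \<inter> space (?M B)) u *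
      indicator (\<Pi>\<^sub>E c\<in>C. {0..1}) v \<partial>?M C \<partial>?M B)"
  proof (intro nn_integral_cong)
    fix u v assume u: "u \<in> space (?M B)" and v: "v \<in> space (?M C)"
    have "merge B C (u, v) \<in> space (?M (B \<union> C))"
      by (auto simp: space_PiM merge_def PiE_def extensional_def)
    then show "indicator (?T -` D \<inter> space (?M (B \<union> C))) (merge B C (u, v)) =
      (indicator (?S -` A \<inter> space (?M B)) u * indicator (\<Pi>\<^sub>E c\<in>C. {0..1}) v :: ennreal)"
      using Tm[of u v] u v
      by (auto simp: indicator_def space_PiM PiE_iff)
  qed
  also have "\<dots> = (\<integral>\<^sup>+u. indicator (?S -` A \<inter> space (?M B)) u \<partial>?M B)"
  proof (intro nn_integral_cong)
    have "emeasure (?M C) (\<Pi>\<^sub>E c\<in>C. {0..1}) = 1"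
      using fin by (simp add: emeasure_PiM)
    moreover have "(\<Pi>\<^sub>E c\<in>C. {0..1::real}) \<in> sets (?M C)"
      using fin by (intro sets_PiM_I_finite) auto
    ultimately show "(\<integral>\<^sup>+v. indicator (?S -` A \<inter> space (?M B)) u *
      indicator (\<Pi>\<^sub>E c\<in>C. {0..1}) v \<partial>?M C) = (indicator (?S -` A \<inter> space (?M B)) u :: ennreal)" for u
      by (simp add: nn_integral_cmult)
  qed
  also have "\<dots> = emeasure (?M B) (?S -` A \<inter> space (?M B))"
    using A by (subst nn_integral_indicator) (auto intro!: measurable_sets)
  also have "\<dots> = emeasure (distr (?M B) borel ?S) A"
    using A by (subst emeasure_distr) auto
  finally show ?thesis unfolding D_def by simp
qed

theorem lborel_on_eq:
  fixes V :: "(real ^ 'n::{finite,wellorder}) set"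
  assumes B: "orthonormal_basis B V"
  shows "lborel_on V = distr (\<Pi>\<^sub>M b\<in>B. lborel) borel (\<lambda>c. \<Sum>b\<in>B. c b *\<^sub>R b)"
proof -
  define B' where "B' = (SOME B. orthonormal_basis B V)"
  have B': "orthonormal_basis B' V"
    unfolding B'_def using B by (rule someI)
  obtain C where C: "orthonormal_basis C (orthogonal_comp V)"
    using orthonormal_basis_exists[OF subspace_orthogonal_comp] by blast
  have proj: "(\<Sum>b\<in>B. (x \<bullet> b) *\<^sub>R b) = (\<Sum>b\<in>B'. (x \<bullet> b) *\<^sub>R b)" for x :: "real^'n::_"
  proof -
    have *: "orthogonal (x - (\<Sum>b\<in>F. (x \<bullet> b) *\<^sub>R b)) w" "(\<Sum>b\<in>F. (x \<bullet> b) *\<^sub>R b) \<in> V"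
      if F: "orthonormal_basis F V" and "w \<in> V" for F w
    proof -
      have sF: "span F = V" using F by (simp add: orthonormal_basis_def)
      have "orthogonal (x - (\<Sum>b\<in>F. (x \<bullet> b) *\<^sub>R b)) b" if "b \<in> F" for b
        using orthonormal_basis_coord[OF F that] by (simp add: orthogonal_def inner_diff_left)
      then show "orthogonal (x - (\<Sum>b\<in>F. (x \<bullet> b) *\<^sub>R b)) w"
        using \<open>w \<in> V\<close> sF orthogonal_to_span by blast
      show "(\<Sum>b\<in>F. (x \<bullet> b) *\<^sub>R b) \<in> V"
        unfolding sF[symmetric] by (intro span_sum span_scale span_base)
    qed
    have V: "subspace V" using B subspace_span[of B] by (simp add: orthonormal_basis_def)
    let ?p = "\<Sum>b\<in>B. (x \<bullet> b) *\<^sub>R b" and ?q = "\<Sum>b\<in>B'. (x \<bullet> b) *\<^sub>R b"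
    have "?p - ?q \<in> V"
      using *(2)[OF B subspace_0[OF V]] *(2)[OF B' subspace_0[OF V]] V by (rule_tac subspace_diff)
    then have "(?p - ?q) \<bullet> (?p - ?q) = 0"
      using *(1)[OF B, of "?p - ?q"] *(1)[OF B', of "?p - ?q"]
      by (simp add: orthogonal_def inner_diff_left)
    then show ?thesis by simp
  qed
  show ?thesis
    unfolding lborel_on_def Let_def B'_def[symmetric]
    by (rule measure_eqI)
      (simp_all add: emeasure_distr_orthonormal_basis[OF B C]
        emeasure_distr_orthonormal_basis[OF B' C] proj)
qed

end

theory Submission
  imports Defs "HOL-Probability.Characteristic_Functions"
begin

text \<open>
  Let X have independent Laplace coordinates and let Z be standard normal. Expanding the Gaussian as
  the characteristic function of Z gives
  E exp (- (t <X, a>)^2 / 2) = E (PROD j. 1 / (1 + (t Z a_j)^2)),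
  and as t tends to infinity, t times the left-hand side concentrates on the hyperplane orthogonal to
  a and tends to a constant times the section volume. So it suffices to maximise
  PROD j. (1 + s a_j^2) for each s separately. With two elementary symmetric functions
  fixed, the product over three coordinates is strictly convex in the third one, hence a maximiser
  has no three distinct coordinates. This leaves vectors with k equal positive and n - k equal
  negative entries, and for those the product increases in k up to n / 2.
\<close>

section \<open>Maximising the product\<close>

text \<open>The products stand in denominators, so a vector that maximises all of them has the
  smallest expectation for every t, and this order survives the limit. The difficulty is that the
  maximiser must not depend on s. The three-coordinate exchange achieves this: it leaves only
  two-valued vectors, and once a block size k is chosen, unit norm and zero sum fix the squared
  entries without reference to s. Block sizes are compared by letting k / n be a real variable. The
  limit in t needs no explicit value. The l1 norm changes by at most
  \<open>l1_norm a * \<bar>y\<bar>\<close> when a point moves by y along \<open>a\<close>, so t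
  times the expectation is squeezed between the integral of exp (- l1 norm) over the hyperplane
  times two perturbed Gaussian integrals. Both perturbed integrals tend to the same positive
  constant, which is independent of \<open>a\<close> and cancels. Homogeneity turns the hyperplane
  integral into (n - 1)! times the section volume.\<close>

text \<open>For s = t^2 the product over x, y, z is |(1 + i t x)(1 + i t y)(1 + i t z)|^2 = (1 - s
  e2)^2 + s (e1 - s e3)^2, with e1, e2, e3 the elementary symmetric functions. After centering, e1
  and e2 depend only on m and \<rho>, so under the two constraints the only free quantity is u v w,
  inside the second square.\<close>

lemma prod_one_plus_square_centered:
  fixes s m u v w \<rho> :: real
  assumes "u + v + w = 0" and "u\<^sup>2 + v\<^sup>2 + w\<^sup>2 = 6 * \<rho>\<^sup>2"
  shows "(1 + s * (m + u)\<^sup>2) * (1 + s * (m + v)\<^sup>2) * (1 + s * (m + w)\<^sup>2) =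
    (1 - 3 * s * (m\<^sup>2 - \<rho>\<^sup>2))\<^sup>2 + s * (3 * m - s * (m ^ 3 - 3 * m * \<rho>\<^sup>2) - s * (u * v * w))\<^sup>2"
proof -
  have w: "w = - u - v" using assms(1) by simp
  have r: "\<rho>\<^sup>2 = (u\<^sup>2 + u * v + v\<^sup>2) / 3"
    using assms(2) unfolding w by (simp add: power2_eq_square algebra_simps)
  show ?thesis unfolding r w by algebra
qed

text \<open>
  The deviations u, v, w from the mean m are replaced by (2 r, - r, - r), where r = \<rho> or r = - \<rho>; these
  give the extreme values of u v w subject to the two constraints, by the sign of the discriminant.
\<close>
lemma three_distinct_values_improvable:
  fixes s x y z :: real
  assumes s: "0 < s" and "x \<noteq> y" "y \<noteq> z" "z \<noteq> x"
  obtains x' y' z' where "x' + y' + z' = x + y + z" "x'\<^sup>2 + y'\<^sup>2 + z'\<^sup>2 = x\<^sup>2 + y\<^sup>2 + z\<^sup>2"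
    "(1 + s * x\<^sup>2) * (1 + s * y\<^sup>2) * (1 + s * z\<^sup>2) <
     (1 + s * x'\<^sup>2) * (1 + s * y'\<^sup>2) * (1 + s * z'\<^sup>2)"
proof -
  define m where "m = (x + y + z) / 3"
  define u v w where "u = x - m" and "v = y - m" and "w = z - m"
  define \<rho> where "\<rho> = sqrt ((u\<^sup>2 + v\<^sup>2 + w\<^sup>2) / 6)"
  have xyz: "x = m + u" "y = m + v" "z = m + w" by (auto simp: u_def v_def w_def)
  have sum: "u + v + w = 0" by (simp add: u_def v_def w_def m_def field_simps)
  have rho: "u\<^sup>2 + v\<^sup>2 + w\<^sup>2 = 6 * \<rho>\<^sup>2" and rho0: "\<rho> \<ge> 0" by (auto simp: \<rho>_def)
  define B where "B = 3 * m - s * (m ^ 3 - 3 * m * \<rho>\<^sup>2)"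
  have "0 < ((u - v) * (v - w) * (w - u))\<^sup>2"
    using assms by (simp add: u_def v_def w_def)
  \<comment> \<open>The discriminant of T^3 - 3 \<rho>^2 T - u v w, the cubic with roots u, v,
    w.\<close>
  also have "\<dots> = 27 * ((2 * \<rho> ^ 3)\<^sup>2 - (u * v * w)\<^sup>2)"
  proof -
    have w: "w = - u - v" using sum by simp
    have r: "u\<^sup>2 + u * v + v\<^sup>2 = 3 * \<rho>\<^sup>2"
      using rho unfolding w by (simp add: power2_eq_square algebra_simps)
    have e: "27 * (2 * \<rho> ^ 3)\<^sup>2 = 4 * (u\<^sup>2 + u * v + v\<^sup>2) ^ 3" unfolding r by algebra
    show ?thesis unfolding w right_diff_distrib e by algebra
  qed
  finally have "(u * v * w)\<^sup>2 < (2 * \<rho> ^ 3)\<^sup>2" by simp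
  then have less: "\<bar>u * v * w\<bar> < 2 * \<rho> ^ 3"
    using rho0 by (metis abs_of_nonneg abs_le_square_iff linorder_not_le mult_nonneg_nonneg
        zero_le_numeral zero_le_power)
  \<comment> \<open>The sign makes the new value of u v w, which is 2 \<sigma> \<rho>^3, opposite to
    \<open>B\<close>, so that the absolute values of \<open>B\<close> and of the s-term add
    up.\<close>
  define \<sigma> :: real where "\<sigma> = (if B \<ge> 0 then -1 else 1)"
  have sg: "\<sigma>\<^sup>2 = 1" "\<sigma> ^ 3 = \<sigma>" by (auto simp: \<sigma>_def)
  define r where "r = \<sigma> * \<rho>"
  have r: "r\<^sup>2 = \<rho>\<^sup>2" "r ^ 3 = \<sigma> * \<rho> ^ 3" by (simp_all add: r_def power_mult_distrib sg)
  have "\<bar>B - s * (u * v * w)\<bar> \<le> \<bar>B\<bar> + s * \<bar>u * v * w\<bar>"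
    using s by (metis abs_mult abs_of_pos abs_triangle_ineq4)
  also have "\<dots> < \<bar>B\<bar> + s * (2 * \<rho> ^ 3)" using less s by simp
  also have "\<dots> = \<bar>B - s * (2 * r * - r * - r)\<bar>"
  proof -
    have t: "s * (2 * r * - r * - r) = \<sigma> * (s * (2 * \<rho> ^ 3))"
      using r(2) by (simp add: power3_eq_cube)
    have "s * (2 * \<rho> ^ 3) \<ge> 0" using s rho0 by simp
    then show ?thesis unfolding t by (auto simp: \<sigma>_def)
  qed
  finally have "(B - s * (u * v * w))\<^sup>2 < (B - s * (2 * r * - r * - r))\<^sup>2"
    by (metis abs_le_square_iff linorder_not_le)
  then have "(1 + s * (m + u)\<^sup>2) * (1 + s * (m + v)\<^sup>2) * (1 + s * (m + w)\<^sup>2) <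
     (1 + s * (m + 2 * r)\<^sup>2) * (1 + s * (m + - r)\<^sup>2) * (1 + s * (m + - r)\<^sup>2)"
    using s sum rho r
    by (subst (1 2) prod_one_plus_square_centered[where \<rho> = \<rho>])
      (simp_all add: B_def power_mult_distrib)
  moreover have "(m + 2 * r) + (m + - r) + (m + - r) = x + y + z" by (simp add: m_def field_simps)
  moreover have "(m + 2 * r)\<^sup>2 + (m + - r)\<^sup>2 + (m + - r)\<^sup>2 = x\<^sup>2 + y\<^sup>2 + z\<^sup>2"
  proof -
    have "x\<^sup>2 + y\<^sup>2 + z\<^sup>2 = 3 * m\<^sup>2 + 2 * m * (u + v + w) + (u\<^sup>2 + v\<^sup>2 + w\<^sup>2)"
      unfolding xyz by algebra
    also have "\<dots> = 3 * m\<^sup>2 + 6 * r\<^sup>2" unfolding sum rho r by simp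
    finally show ?thesis by algebra
  qed
  ultimately show ?thesis using that xyz by metis
qed

section \<open>Comparison of block sizes\<close>

text \<open>With p = k / n and \<sigma> = s / n, \<phi> is 1 / n times the logarithm of the product
  for block sizes k and n - k, so growth in k becomes the sign of a derivative. The logarithmic part
  of that derivative is bounded below by ln (A / B) \<ge> 1 - B / A, where p \<le> 1/2 gives B \<le>
  A.\<close>

lemma two_point_weighted_log_mono:
  fixes \<sigma> p q :: real
  defines "\<phi> \<equiv> \<lambda>p. p * ln (1 + \<sigma> * (1 - p) / p) + (1 - p) * ln (1 + \<sigma> * p / (1 - p))"
  assumes s: "0 \<le> \<sigma>" and p: "0 < p" "p \<le> q" "q \<le> 1 / 2"
  shows "\<phi> p \<le> \<phi> q"
proof (rule DERIV_nonneg_imp_nondecreasing[OF p(2)])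
  fix x assume "p \<le> x" "x \<le> q"
  then have x: "0 < x" "x \<le> 1 / 2" using p by auto
  define A B where "A = 1 + \<sigma> * (1 - x) / x" and "B = 1 + \<sigma> * x / (1 - x)"
  have pos: "0 < A" "0 < B" "1 \<le> B" using s x by (auto simp: A_def B_def add_pos_nonneg)
  have "x / (1 - x) \<le> 1" "1 \<le> (1 - x) / x" using x by (auto simp: field_simps)
  then have AB: "B \<le> A"
    using s mult_left_mono[of "x / (1 - x)" "(1 - x) / x" \<sigma>] by (auto simp: A_def B_def)
  have d: "(\<phi> has_real_derivative (ln A - \<sigma> / x / A - ln B + \<sigma> / (1 - x) / B)) (at x)"
  proof -
    have 1: "((\<lambda>p. ln (1 + \<sigma> * (1 - p) / p)) has_real_derivative (- \<sigma> / x\<^sup>2 / A)) (at x)"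
      using x pos(1) unfolding A_def
      by (auto intro!: derivative_eq_intros simp: power2_eq_square field_simps)
    have 2: "((\<lambda>p. ln (1 + \<sigma> * p / (1 - p))) has_real_derivative (\<sigma> / (1 - x)\<^sup>2 / B)) (at x)"
      using x pos(2) unfolding B_def
      by (auto intro!: derivative_eq_intros simp: power2_eq_square field_simps)
    have "((\<lambda>p. p * ln (1 + \<sigma> * (1 - p) / p) + (1 - p) * ln (1 + \<sigma> * p / (1 - p)))
       has_real_derivative (1 * ln A + - \<sigma> / x\<^sup>2 / A * x +
         ((0 - 1) * ln B + \<sigma> / (1 - x)\<^sup>2 / B * (1 - x)))) (at x)"
      unfolding A_def B_def
      by (intro DERIV_add DERIV_mult DERIV_diff DERIV_ident DERIV_const
          1[unfolded A_def] 2[unfolded B_def])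
    moreover have "1 * ln A + - \<sigma> / x\<^sup>2 / A * x + ((0 - 1) * ln B + \<sigma> / (1 - x)\<^sup>2 / B * (1 - x)) =
      ln A - \<sigma> / x / A - ln B + \<sigma> / (1 - x) / B"
      using x by (simp add: power2_eq_square)
    ultimately show ?thesis unfolding \<phi>_def by (rule DERIV_cong)
  qed
  moreover have "0 \<le> ln A - \<sigma> / x / A - ln B + \<sigma> / (1 - x) / B"
  proof -
    have "ln (B / A) \<le> B / A - 1" using pos by (intro ln_le_minus_one) simp
    then have "1 - B / A \<le> ln A - ln B" using pos by (simp add: ln_div)
    moreover have "\<sigma> / x / A - \<sigma> / (1 - x) / B \<le> 1 - B / A"
    proof -
      \<comment> \<open>Eliminating x this way makes the remaining rational expression factor with A
        - B as a factor.\<close>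
      have e: "\<sigma> / x = A - 1 + \<sigma>" "\<sigma> / (1 - x) = B - 1 + \<sigma>"
        using x by (auto simp: A_def B_def field_simps)
      have "1 - B / A - (\<sigma> / x / A - \<sigma> / (1 - x) / B) = (A - B) * (B - 1 + \<sigma>) / (A * B)"
        unfolding e using pos(1,2) by (simp add: field_simps)
      moreover have "0 \<le> (A - B) * (B - 1 + \<sigma>) / (A * B)" using AB pos s by simp
      ultimately show ?thesis by linarith
    qed
    ultimately show ?thesis by linarith
  qed
  ultimately show "\<exists>y. (\<phi> has_real_derivative y) (at x) \<and> 0 \<le> y" by blast
qed

text \<open>The two fractions are the squared entries forced by unit norm and zero sum on a vector
  with k entries of one value and n - k of another.\<close>

lemma two_block_prod_mono:
  fixes s :: real and n k l :: nat
  defines "F \<equiv> \<lambda>k. (1 + s * (real (n - k) / (real k * real n))) ^ k *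
    (1 + s * (real k / (real (n - k) * real n))) ^ (n - k)"
  assumes s: "0 \<le> s" and k: "0 < k" "k \<le> l" "2 * l \<le> n"
  shows "F k \<le> F l"
proof -
  define \<phi> where "\<phi> p = p * ln (1 + s / n * (1 - p) / p) + (1 - p) * ln (1 + s / n * p / (1 - p))" for p
  have F: "F j = exp (n * \<phi> (j / n)) \<and> 0 < j / n" if j: "0 < j" "2 * j \<le> n" for j
  proof -
    have jn: "0 < n - j" "0 < n" "real (n - j) = real n - real j" using j by auto
    have q: "1 - j / n = (n - j) / n" using jn by (simp add: field_simps)
    have "n * \<phi> (j / n) = j * ln (1 + s * (real (n - j) / (real j * real n))) +
       (n - j) * ln (1 + s * (real j / (real (n - j) * real n)))"
    proof -
      have "s / n * ((n - j) / n) / (j / n) = s * (real (n - j) / (real j * real n))"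
        "s / n * (j / n) / ((n - j) / n) = s * (real j / (real (n - j) * real n))"
        using jn by (simp_all del: of_nat_diff)
      then show ?thesis unfolding \<phi>_def q using jn j(1) by (simp add: distrib_left mult_ac del: of_nat_diff)
    qed
    moreover have "0 < 1 + s * (real (n - j) / (real j * real n))"
      "0 < 1 + s * (real j / (real (n - j) * real n))"
      using s by (auto intro!: add_pos_nonneg)
    ultimately show ?thesis using j unfolding F_def
      by (simp add: exp_add exp_of_nat_mult del: of_nat_diff)
  qed
  have "\<phi> (k / n) \<le> \<phi> (l / n)"
    unfolding \<phi>_def using k s by (intro two_point_weighted_log_mono) (auto simp: field_simps)
  then show ?thesis using F[of k] F[of l] k by (auto intro: mult_left_mono)
qed

section \<open>Existence and shape of a product maximiser\<close>

lemma compact_unit_zero_sum: "compact (unit_zero_sum :: (real ^ 'n) set)"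
proof -
  have n: "(\<Sum>r\<in>UNIV. (a $ r)\<^sup>2) = a \<bullet> a" for a :: "real ^ 'n"
    by (simp add: inner_vec_def power2_eq_square)
  have "closed {a :: real ^ 'n. a \<bullet> a = 1 \<and> (\<Sum>r\<in>UNIV. a $ r) = 0}"
    by (intro closed_Collect_conj closed_Collect_eq continuous_intros)
  moreover have "{a :: real ^ 'n. a \<bullet> a = 1 \<and> (\<Sum>r\<in>UNIV. a $ r) = 0} \<subseteq> cball 0 1"
    by (auto simp: norm_eq_sqrt_inner)
  ultimately show ?thesis
    unfolding unit_zero_sum_def n using compact_eq_bounded_closed bounded_subset bounded_cball by blast
qed

text \<open>The number of predecessors is strictly increasing in i, hence injective into
  \<open>{..<CARD('n)}\<close>, hence onto by counting.\<close>

lemma card_initial_positions: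
  fixes k :: nat
  assumes "k \<le> CARD('n::{finite,wellorder})"
  shows "card {i :: 'n. card {j. j < i} < k} = k"
proof -
  let ?f = "\<lambda>i :: 'n. card {j. j < i}"
  have lt: "?f i < ?f i'" if "i < i'" for i i'
    using that by (intro psubset_card_mono) auto
  have inj: "inj ?f"
    by (rule injI) (metis lt linorder_less_linear nat_neq_iff)
  have "range ?f \<subseteq> {..<CARD('n)}"
    by (auto intro!: psubset_card_mono)
  moreover have "card (range ?f) = CARD('n)" using inj by (simp add: card_image)
  ultimately have rng: "range ?f = {..<CARD('n)}" by (intro card_subset_eq) auto
  have "?f ` {i. ?f i < k} = {..<k}"
  proof -
    have "{..<k} \<subseteq> ?f ` {i. ?f i < k}"
    proof
      fix m assume m: "m \<in> {..<k}"
      then have "m \<in> range ?f" using rng assms by auto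
      then show "m \<in> ?f ` {i. ?f i < k}" using m by auto
    qed
    then show ?thesis by auto
  qed
  then show ?thesis using inj
    by (metis card_image card_lessThan inj_on_subset subset_UNIV)
qed

lemma
  fixes g :: "'b \<Rightarrow> 'c::comm_semiring_1" and f :: "'a::finite \<Rightarrow> 'b"
  assumes "\<And>i. f i = (if i \<in> S then c else d)" and "card S = k"
  shows sum_two_values: "(\<Sum>i\<in>UNIV. g (f i)) = of_nat k * g c + of_nat (CARD('a) - k) * g d"
    and prod_two_values: "(\<Prod>i\<in>UNIV. g (f i)) = g c ^ k * g d ^ (CARD('a) - k)"
proof -
  have c: "card (- S) = CARD('a) - k" using assms(2) by (simp add: Compl_eq_Diff_UNIV card_Diff_subset)
  have "(\<Sum>i\<in>S. g (f i)) = of_nat k * g c" "(\<Sum>i\<in>-S. g (f i)) = of_nat (CARD('a) - k) * g d"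
    using assms(2) c by (simp_all add: assms(1))
  moreover have "UNIV = S \<union> - S" by auto
  ultimately show "(\<Sum>i\<in>UNIV. g (f i)) = of_nat k * g c + of_nat (CARD('a) - k) * g d"
    by (metis Compl_disjoint finite sum.union_disjoint)
  have "(\<Prod>i\<in>S. g (f i)) = g c ^ k" "(\<Prod>i\<in>-S. g (f i)) = g d ^ (CARD('a) - k)"
    using assms(2) c by (simp_all add: assms(1))
  moreover have "UNIV = S \<union> - S" by auto
  ultimately show "(\<Prod>i\<in>UNIV. g (f i)) = g c ^ k * g d ^ (CARD('a) - k)"
    by (metis Compl_disjoint finite prod.union_disjoint)
qed

lemma
  fixes k :: nat
  assumes k: "0 < k" "k < CARD('n::{finite,wellorder})"
  defines "n \<equiv> CARD('n)"
  defines "a \<equiv> two_block k (sqrt (real (n - k) / (real k * real n)))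
     (- sqrt (real k / (real (n - k) * real n))) :: real ^ 'n::_"
  shows balanced_two_block_mem: "a \<in> unit_zero_sum"
    and balanced_two_block_prod: "(\<Prod>i\<in>UNIV. 1 + s * (a $ i)\<^sup>2) =
      (1 + s * (real (n - k) / (real k * real n))) ^ k *
      (1 + s * (real k / (real (n - k) * real n))) ^ (n - k)"
proof -
  let ?c = "real (n - k) / (real k * real n)" and ?d = "real k / (real (n - k) * real n)"
  have a: "a $ i = (if i \<in> {i. card {j. j < i} < k} then sqrt ?c else - sqrt ?d)" for i
    by (simp add: a_def two_block_def)
  note S = sum_two_values[of "\<lambda>i. a $ i", OF a card_initial_positions[OF less_imp_le[OF k(2)]],
      folded n_def]
    prod_two_values[of "\<lambda>i. a $ i", OF a card_initial_positions[OF less_imp_le[OF k(2)]],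
      folded n_def]
  have nk: "0 < real (n - k)" "0 < real k" "0 < real n" "real (n - k) = real n - real k"
    using k by (auto simp: n_def)
  have "real k * ?c = real (n - k) / n" "real (n - k) * ?d = k / n"
    using nk(1-3) by (simp_all del: of_nat_diff)
  then have "real k * ?c + real (n - k) * ?d = 1"
    using nk(3,4) by (simp add: add_divide_distrib[symmetric])
  then have "(\<Sum>i\<in>UNIV. (a $ i)\<^sup>2) = 1"
    unfolding S(1)[of "\<lambda>x. x\<^sup>2"] by simp
  moreover have "(\<Sum>i\<in>UNIV. a $ i) = 0"
  proof -
    have "real k * sqrt ?c = real (n - k) * sqrt ?d"
    proof (rule power2_eq_imp_eq)
      show "(real k * sqrt ?c)\<^sup>2 = (real (n - k) * sqrt ?d)\<^sup>2"
        unfolding power_mult_distrib using nk(1-3)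
        by (simp del: of_nat_diff) (simp add: power2_eq_square del: of_nat_diff)
    qed auto
    then show ?thesis unfolding S(1)[of "\<lambda>x. x"] by simp
  qed
  ultimately show "a \<in> unit_zero_sum" by (simp add: unit_zero_sum_def)
  show "(\<Prod>i\<in>UNIV. 1 + s * (a $ i)\<^sup>2) = (1 + s * ?c) ^ k * (1 + s * ?d) ^ (n - k)"
    unfolding S(2)[of "\<lambda>x. 1 + s * x\<^sup>2"] using nk by simp
qed

text \<open>The multiplicity k determines both squared entries, and the product sees only squares,
  so neither the order of the entries nor their signs matter.\<close>

lemma unit_zero_sum_two_values:
  fixes a :: "real ^ 'n"
  defines "n \<equiv> CARD('n)"
  assumes a: "a \<in> unit_zero_sum" and ab: "\<And>i. a $ i = c \<or> a $ i = d"
  shows "\<exists>k. 0 < k \<and> k < n \<and> (\<Prod>i\<in>UNIV. 1 + s * (a $ i)\<^sup>2) =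
      (1 + s * (real (n - k) / (real k * real n))) ^ k *
      (1 + s * (real k / (real (n - k) * real n))) ^ (n - k)"
proof -
  define S k where "S = {i. a $ i = c}" and "k = card S"
  have ai: "a $ i = (if i \<in> S then c else d)" for i using ab[of i] by (auto simp: S_def)
  note S = sum_two_values[of "\<lambda>i. a $ i", OF ai k_def[symmetric], folded n_def]
    prod_two_values[of "\<lambda>i. a $ i", OF ai k_def[symmetric], folded n_def]
  have kn: "k \<le> n" unfolding k_def n_def by (intro card_mono) auto
  have 1: "k * c\<^sup>2 + (n - k) * d\<^sup>2 = 1" and 0: "k * c + (n - k) * d = 0"
    using a S(1)[of "\<lambda>x. x\<^sup>2"] S(1)[of "\<lambda>x. x"] by (auto simp: unit_zero_sum_def)
  \<comment> \<open>Multiplicity 0 or n would make the vector constant, which zero sum and unit norm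
    exclude; this also disposes of c = d.\<close>
  have "k \<noteq> 0"
  proof
    assume "k = 0"
    with 0 1 show False by (cases "d = 0") auto
  qed
  moreover have "n - k \<noteq> 0"
  proof
    assume "n - k = 0"
    with 0 1 show False by (cases "c = 0") auto
  qed
  ultimately have pos: "0 < real k" "0 < real (n - k)" "0 < k" "k < n" "real (n - k) = real n - real k" by auto
  \<comment> \<open>Multiply the norm equation by n - k and replace ((n - k) d)^2 by (k c)^2; the
    second equation is symmetric.\<close>
  have "real (n - k) = real k * (real (n - k) + real k) * c\<^sup>2"
    "real k = real (n - k) * (real (n - k) + real k) * d\<^sup>2"
    using 0 1 by algebra+
  moreover have "real (n - k) + real k = n" using pos by simp
  ultimately have "c\<^sup>2 = real (n - k) / (real k * real n)" "d\<^sup>2 = real k / (real (n - k) * real n)"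
    using pos(1,2) by (auto simp: field_simps)
  then show ?thesis
    using S(2)[of "\<lambda>x. 1 + s * x\<^sup>2"] pos by auto
qed

text \<open>Exchange argument: the improved triple keeps the sum and the sum of squares, so the
  modified vector is still admissible, and the other factors of the product are positive and
  cancel.\<close>

lemma prod_maximizer_two_values:
  fixes m :: "real ^ 'n"
  assumes s: "0 < s" and m: "m \<in> unit_zero_sum"
    and max: "\<And>a :: real ^ 'n. a \<in> unit_zero_sum \<Longrightarrow> (\<Prod>i\<in>UNIV. 1 + s * (a $ i)\<^sup>2) \<le> (\<Prod>i\<in>UNIV. 1 + s * (m $ i)\<^sup>2)"
  shows "m $ i = m $ j \<or> m $ j = m $ k \<or> m $ k = m $ i"
proof (rule ccontr)
  assume "\<not> ?thesis"
  then have ne: "m $ i \<noteq> m $ j" "m $ j \<noteq> m $ k" "m $ k \<noteq> m $ i" by auto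
  then have ijk: "i \<noteq> j" "j \<noteq> k" "k \<noteq> i" by auto
  obtain x y z where xyz: "x + y + z = m $ i + m $ j + m $ k"
    "x\<^sup>2 + y\<^sup>2 + z\<^sup>2 = (m $ i)\<^sup>2 + (m $ j)\<^sup>2 + (m $ k)\<^sup>2"
    "(1 + s * (m $ i)\<^sup>2) * (1 + s * (m $ j)\<^sup>2) * (1 + s * (m $ k)\<^sup>2) <
     (1 + s * x\<^sup>2) * (1 + s * y\<^sup>2) * (1 + s * z\<^sup>2)"
    using three_distinct_values_improvable[OF s ne] by blast
  define a where "a = (\<chi> l. if l = i then x else if l = j then y else if l = k then z else m $ l)"
  let ?R = "UNIV - {i, j, k}"
  have a: "a $ i = x" "a $ j = y" "a $ k = z" "\<And>l. l \<in> ?R \<Longrightarrow> a $ l = m $ l"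
    using ijk by (auto simp: a_def)
  have sum3: "(\<Sum>l\<in>UNIV. g l) = (g i + g j + g k) + (\<Sum>l\<in>?R. g l)" for g :: "'n \<Rightarrow> real"
    using sum.subset_diff[of "{i, j, k}" UNIV g] ijk by auto
  have prod3: "(\<Prod>l\<in>UNIV. g l) = (g i * g j * g k) * (\<Prod>l\<in>?R. g l)" for g :: "'n \<Rightarrow> real"
    using prod.subset_diff[of "{i, j, k}" UNIV g] ijk by (auto simp: mult_ac)
  have "a \<in> unit_zero_sum"
    using m xyz(1,2) unfolding unit_zero_sum_def by (simp add: sum3 a)
  from max[OF this] have "(1 + s * x\<^sup>2) * (1 + s * y\<^sup>2) * (1 + s * z\<^sup>2) * (\<Prod>l\<in>?R. 1 + s * (m $ l)\<^sup>2) \<le>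
    (1 + s * (m $ i)\<^sup>2) * (1 + s * (m $ j)\<^sup>2) * (1 + s * (m $ k)\<^sup>2) * (\<Prod>l\<in>?R. 1 + s * (m $ l)\<^sup>2)"
    by (simp add: prod3 a)
  moreover have "0 < (\<Prod>l\<in>?R. 1 + s * (m $ l)\<^sup>2)" using s by (intro prod_pos) (auto intro: add_pos_nonneg)
  ultimately show False using xyz(3) by (simp only: mult_le_cancel_right_pos)
qed

lemma prod_one_plus_square_le_two_block:
  fixes a :: "real ^ 'n::{finite,wellorder}"
  defines "n \<equiv> CARD('n)"
  assumes a: "a \<in> unit_zero_sum" and s: "0 \<le> s" and n: "2 \<le> n" and k: "k = n div 2"
  shows "(\<Prod>i\<in>UNIV. 1 + s * (a $ i)\<^sup>2) \<le>
     (1 + s * (real (n - k) / (real k * real n))) ^ k *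
     (1 + s * (real k / (real (n - k) * real n))) ^ (n - k)" (is "_ \<le> ?F k")
proof (cases "s = 0")
  case False
  with s have s: "0 < s" by simp
  have "continuous_on unit_zero_sum (\<lambda>a :: real ^ 'n::_. \<Prod>i\<in>UNIV. 1 + s * (a $ i)\<^sup>2)"
    by (intro continuous_intros)
  then obtain m :: "real ^ 'n::_" where m: "m \<in> unit_zero_sum" and
    max: "\<And>a :: real ^ 'n::_. a \<in> unit_zero_sum \<Longrightarrow> (\<Prod>i\<in>UNIV. 1 + s * (a $ i)\<^sup>2) \<le> (\<Prod>i\<in>UNIV. 1 + s * (m $ i)\<^sup>2)"
    using continuous_attains_sup[OF compact_unit_zero_sum] a by blast
  have "\<exists>c d. \<forall>i. m $ i = c \<or> m $ i = d"
  proof (cases "\<exists>i j. m $ i \<noteq> m $ j")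
    case True
    then obtain i j where "m $ i \<noteq> m $ j" by blast
    then have "m $ k = m $ i \<or> m $ k = m $ j" for k
      using prod_maximizer_two_values[OF s m max, of i j k] by auto
    then show ?thesis by blast
  qed blast
  then obtain c d where cd: "\<And>i. m $ i = c \<or> m $ i = d" by blast
  obtain l where l: "0 < l" "l < n" "(\<Prod>i\<in>UNIV. 1 + s * (m $ i)\<^sup>2) = ?F l"
    using unit_zero_sum_two_values[OF m cd] unfolding n_def by blast
  have mono: "?F j \<le> ?F k" if "0 < j" "2 * j \<le> n" for j
    using that s k by (intro two_block_prod_mono) auto
  have "?F l \<le> ?F k"
  proof (cases "2 * l \<le> n")
    case False
    \<comment> \<open>Swapping the blocks, which amounts to negating the vector, exchanges the two
      factors; this moves l into the range l \<le> n / 2 where monotonicity is available.\<close>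
    have "n - (n - l) = l" using l by simp
    then have "?F l = ?F (n - l)" by (simp only: mult.commute)
    also have "\<dots> \<le> ?F k" using False l by (intro mono) auto
    finally show ?thesis .
  qed (use mono l in auto)
  with max[OF a] l show ?thesis by simp
qed simp

section \<open>Fourier representation\<close>

lemma integrable_exp_minus_abs: "integrable lborel (\<lambda>x :: real. exp (- \<bar>x\<bar>))"
proof -
  have "has_bochner_integral lborel (\<lambda>x. indicator {0..} x *\<^sub>R exp (- \<bar>x\<bar>)) (1 :: real)"
  proof (rule has_bochner_integral_nn_integral)
    have "(\<integral>\<^sup>+x. ennreal (indicator {0..} x *\<^sub>R exp (- \<bar>x\<bar>)) \<partial>lborel) =
      (\<integral>\<^sup>+x. ennreal (x ^ 0 * exp (- x)) * indicator {0..} x \<partial>lborel)"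
      by (intro nn_integral_cong) (auto simp: indicator_def)
    then show "(\<integral>\<^sup>+x. ennreal (indicator {0..} x *\<^sub>R exp (- \<bar>x\<bar>)) \<partial>lborel) = ennreal (1 :: real)"
      unfolding nn_intergal_power_times_exp_Ici by simp
  qed auto
  from has_bochner_integral_even_function[OF this] show ?thesis
    by (auto intro: integrable.intros)
qed

lemma exp_mult_has_vector_derivative:
  assumes "c \<noteq> 0"
  shows "((\<lambda>x. exp (c * complex_of_real x) / c) has_vector_derivative exp (c * of_real x)) (at x)"
proof -
  have "((\<lambda>z. exp (c * z) / c) has_field_derivative exp (c * of_real x)) (at (of_real x))"
    using assms by (auto intro!: derivative_eq_intros)
  then show ?thesis by (rule has_vector_derivative_real_field)
qed

lemma
  fixes t :: real
  defines "f \<equiv> \<lambda>x. complex_of_real (exp (- \<bar>x\<bar>)) * iexp (t * x)"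
  shows integrable_laplace_iexp: "integrable lborel f"
    and integral_laplace_iexp: "(CLINT x|lborel. f x) = of_real (2 / (1 + t\<^sup>2))"
proof -
  show int: "integrable lborel f"
    unfolding f_def
    by (rule Bochner_Integration.integrable_bound[OF integrable_exp_minus_abs])
      (auto simp: norm_mult)
  then have si: "set_integrable lborel (einterval a b) f" for a b
    unfolding set_integrable_def by (intro integrable_mult_indicator) auto
  have cont: "isCont f x" for x unfolding f_def by (intro continuous_intros)
  \<comment> \<open>The rates of the pure exponentials that f equals on the positive and on the
    negative half-line; the integral comes out as 1 / q - 1 / p.\<close>
  define p q where "p = - 1 + \<i> * t" and "q = 1 + \<i> * t"
  have nz: "p \<noteq> 0" "q \<noteq> 0" by (auto simp: p_def q_def complex_eq_iff)
  have fp: "f x = exp (p * of_real x)" if "0 < x" for x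
    using that by (simp add: f_def p_def exp_add[symmetric] exp_of_real[symmetric] algebra_simps)
  have fq: "f x = exp (q * of_real x)" if "x < 0" for x
    using that by (simp add: f_def q_def exp_add[symmetric] exp_of_real[symmetric] algebra_simps)
  have lim0: "((\<lambda>x. exp (c * complex_of_real x) / c) \<longlongrightarrow> exp (c * of_real 0) / c) (at 0 within S)"
    if "c \<noteq> 0" for c S using that by (intro tendsto_intros) auto
  have "(CLBINT x=ereal 0..\<infinity>. f x) = 0 - exp (p * of_real 0) / p"
  proof (rule interval_integral_FTC_integrable[OF _ _ cont si])
    have "((\<lambda>x. exp (- x) / norm p) \<longlongrightarrow> 0 / norm p) at_top"
      using nz by (intro tendsto_divide tendsto_const filterlim_compose[OF exp_at_bot filterlim_uminus_at_bot_at_top]) auto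
    then have "((\<lambda>x. exp (p * complex_of_real x) / p) \<longlongrightarrow> 0) at_top"
      by (subst tendsto_norm_zero_iff[symmetric]) (simp add: norm_divide p_def)
    then show "(((\<lambda>x. exp (p * complex_of_real x) / p) \<circ> real_of_ereal) \<longlongrightarrow> 0) (at_left \<infinity>)"
      unfolding ereal_tendsto_simps .
    show "(((\<lambda>x. exp (p * complex_of_real x) / p) \<circ> real_of_ereal) \<longlongrightarrow> exp (p * of_real 0) / p) (at_right (ereal 0))"
      unfolding ereal_tendsto_simps using nz(1) by (rule lim0)
    show "((\<lambda>x. exp (p * complex_of_real x) / p) has_vector_derivative f x) (at x)"
      if "ereal 0 < ereal x" for x
      using that nz by (simp add: fp exp_mult_has_vector_derivative)
  qed auto
  moreover have "(CLBINT x=-\<infinity>..ereal 0. f x) = exp (q * of_real 0) / q - 0"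
  proof (rule interval_integral_FTC_integrable[OF _ _ cont si])
    have "((\<lambda>x. exp x / norm q) \<longlongrightarrow> 0 / norm q) at_bot"
      using nz by (intro tendsto_divide tendsto_const exp_at_bot) auto
    then have "((\<lambda>x. exp (q * complex_of_real x) / q) \<longlongrightarrow> 0) at_bot"
      by (subst tendsto_norm_zero_iff[symmetric]) (simp add: norm_divide q_def)
    then show "(((\<lambda>x. exp (q * complex_of_real x) / q) \<circ> real_of_ereal) \<longlongrightarrow> 0) (at_right (- \<infinity>))"
      unfolding ereal_tendsto_simps .
    show "(((\<lambda>x. exp (q * complex_of_real x) / q) \<circ> real_of_ereal) \<longlongrightarrow> exp (q * of_real 0) / q) (at_left (ereal 0))"
      unfolding ereal_tendsto_simps using nz(2) by (rule lim0)
    show "((\<lambda>x. exp (q * complex_of_real x) / q) has_vector_derivative f x) (at x)"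
      if "ereal x < ereal 0" for x
      using that nz by (simp add: fq exp_mult_has_vector_derivative)
  qed auto
  moreover have "(CLBINT x=-\<infinity>..ereal 0. f x) + (CLBINT x=ereal 0..\<infinity>. f x) = (CLBINT x=-\<infinity>..\<infinity>. f x)"
    using si[of "-\<infinity>" \<infinity>] by (intro interval_integral_sum) (simp add: interval_lebesgue_integrable_def)
  moreover have "(CLBINT x=-\<infinity>..\<infinity>. f x) = (CLINT x|lborel. f x)"
    by (simp add: interval_lebesgue_integral_def set_lebesgue_integral_def)
  moreover have "1 / q - 1 / p = of_real (2 / (1 + t\<^sup>2))"
  proof -
    have "1 / q - 1 / p = (p - q) / (p * q)" using nz by (simp add: field_simps)
    also have "p - q = - 2" by (simp add: p_def q_def)
    also have "p * q = - of_real (1 + t\<^sup>2)"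
      by (simp add: p_def q_def algebra_simps power2_eq_square)
    finally show ?thesis by (simp only: minus_divide_divide of_real_divide of_real_numeral)
  qed
  ultimately show "(CLINT x|lborel. f x) = of_real (2 / (1 + t\<^sup>2))" by simp
qed

text \<open>The gauge of the cross-polytope, written over \<open>Basis\<close> because Lebesgue
  measure is built as a product over \<open>Basis\<close>; \<open>sum_Basis_vec\<close> translates
  to coordinates.\<close>

definition l1_norm :: "'a::euclidean_space \<Rightarrow> real" where
  "l1_norm x = (\<Sum>b\<in>Basis. \<bar>x \<bullet> b\<bar>)"

lemma continuous_on_l1_norm [continuous_intros]:
  "continuous_on S f \<Longrightarrow> continuous_on S (\<lambda>x. l1_norm (f x))"
  unfolding l1_norm_def by (intro continuous_intros)

lemma l1_norm_measurable [measurable]: "l1_norm \<in> borel_measurable borel"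
  by (intro borel_measurable_continuous_onI continuous_intros)

lemma l1_norm_nonneg: "0 \<le> l1_norm x"
  by (simp add: l1_norm_def sum_nonneg)

lemma l1_norm_triangle: "l1_norm (x + y) \<le> l1_norm x + l1_norm y"
  unfolding l1_norm_def sum.distrib[symmetric] by (intro sum_mono) (simp add: inner_add_left)

lemma l1_norm_scaleR: "l1_norm (c *\<^sub>R x) = \<bar>c\<bar> * l1_norm x"
  by (simp add: l1_norm_def abs_mult sum_distrib_left)

lemma l1_norm_add_scaleR_bounds:
  "l1_norm (x + y *\<^sub>R a) \<le> l1_norm x + l1_norm a * \<bar>y\<bar>"
  "l1_norm x - l1_norm a * \<bar>y\<bar> \<le> l1_norm (x + y *\<^sub>R a)"
  using l1_norm_triangle[of x "y *\<^sub>R a"] l1_norm_triangle[of "x + y *\<^sub>R a" "(- y) *\<^sub>R a"]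
  by (simp_all add: l1_norm_scaleR mult.commute del: scaleR_minus_left) simp_all

lemma
  fixes a :: "'a::euclidean_space" and t :: real
  defines "f \<equiv> \<lambda>x :: 'a. complex_of_real (exp (- l1_norm x)) * iexp (t * (x \<bullet> a))"
  shows integrable_multi_laplace_iexp: "integrable lborel f"
    and integral_multi_laplace_iexp:
      "(CLINT x|lborel. f x) = of_real (\<Prod>b\<in>Basis. 2 / (1 + (t * (a \<bullet> b))\<^sup>2))"
proof -
  interpret product_sigma_finite "\<lambda>_::'a. lborel :: real measure" by standard
  have fm: "f \<in> borel_measurable borel" unfolding f_def by measurable
  define g where "g b x = complex_of_real (exp (- \<bar>x\<bar>)) * iexp (t * (a \<bullet> b) * x)" for b :: 'a and x
  have f: "f (\<Sum>b\<in>Basis. c b *\<^sub>R b) = (\<Prod>b\<in>Basis. g b (c b))" for c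
  proof -
    have "(\<Sum>b\<in>Basis. c b *\<^sub>R b) \<bullet> a = (\<Sum>b\<in>Basis. (a \<bullet> b) * c b)"
      by (simp add: inner_sum_left inner_commute[of a] mult.commute)
    moreover have "l1_norm (\<Sum>b\<in>Basis. c b *\<^sub>R b) = (\<Sum>b\<in>Basis. \<bar>c b\<bar>)"
      by (simp add: l1_norm_def)
    ultimately show ?thesis
      unfolding f_def g_def
      by (simp add: prod.distrib sum_distrib_left exp_sum sum_negf[symmetric] mult.assoc)
  qed
  have int: "integrable lborel (g b)" for b unfolding g_def by (rule integrable_laplace_iexp)
  have 1: "integrable (\<Pi>\<^sub>M b\<in>Basis. lborel) (\<lambda>c. \<Prod>b\<in>Basis. g b (c b))"
    using int by (intro product_integrable_prod) auto
  then show "integrable lborel f"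
    by (subst lborel_eq) (simp add: integrable_distr_eq fm f)
  have "(CLINT x|lborel. f x) = (CLINT c|\<Pi>\<^sub>M b\<in>Basis. lborel. (\<Prod>b\<in>Basis. g b (c b)))"
    by (subst lborel_eq) (simp add: integral_distr fm f)
  also have "\<dots> = (\<Prod>b\<in>Basis. CLINT x|lborel. g b x)"
    using int by (intro product_integral_prod) auto
  also have "\<dots> = of_real (\<Prod>b\<in>Basis. 2 / (1 + (t * (a \<bullet> b))\<^sup>2))"
    unfolding g_def integral_laplace_iexp by simp
  finally show "(CLINT x|lborel. f x) = \<dots>" .
qed

lemma integrable_exp_minus_l1_norm: "integrable lborel (\<lambda>x :: 'a::euclidean_space. exp (- l1_norm x))"
  using integrable_norm[OF integrable_multi_laplace_iexp[where 'a='a and t=0]]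
  by simp

text \<open>The Laplace density is left unnormalised, with total mass 2 per coordinate; this is the
  origin of the numerators 2.\<close>

lemma integral_laplace_gaussian:
  fixes a :: "'a::euclidean_space" and t :: real
  shows "(LINT x|lborel. exp (- l1_norm x) * exp (- (t * (x \<bullet> a))\<^sup>2 / 2)) =
    (LINT z|std_normal_distribution. (\<Prod>b\<in>Basis. 2 / (1 + (t * z)\<^sup>2 * (a \<bullet> b)\<^sup>2)))"
proof -
  let ?N = std_normal_distribution
  interpret N: real_distribution ?N by (rule real_dist_normal_dist)
  interpret pair_sigma_finite "lborel :: 'a measure" ?N ..
  define f where "f x z = complex_of_real (exp (- l1_norm x)) * iexp (t * z * (x \<bullet> a))" for x z
  have [measurable]: "case_prod f \<in> borel_measurable (lborel \<Otimes>\<^sub>M ?N)"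
    unfolding f_def by measurable
  have "integrable (lborel \<Otimes>\<^sub>M ?N) (case_prod f)"
  proof (rule Fubini_integrable)
    show "integrable lborel (\<lambda>x. LINT z|?N. norm (case_prod f (x, z)))"
      using integrable_exp_minus_l1_norm[where 'a='a] by (simp add: f_def norm_mult N.prob_space del: N.space_eq_univ)
    show "AE x in lborel. integrable ?N (\<lambda>z. case_prod f (x, z))"
      by (intro AE_I2 N.integrable_const_bound[of _ "exp (- l1_norm x)" for x])
        (auto simp: f_def norm_mult)
  qed simp
  from Fubini_integral[OF this]
  have "(CLINT z|?N. CLINT x|lborel. f x z) = (CLINT x|lborel. CLINT z|?N. f x z)" .
  moreover have "(CLINT x|lborel. f x z) =
      of_real (\<Prod>b\<in>Basis. 2 / (1 + (t * z)\<^sup>2 * (a \<bullet> b)\<^sup>2))" for z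
    unfolding f_def integral_multi_laplace_iexp by (simp add: power_mult_distrib)
  moreover have "(CLINT z|?N. f x z) = of_real (exp (- l1_norm x) * exp (- (t * (x \<bullet> a))\<^sup>2 / 2))" for x
    using fun_cong[OF char_std_normal_distribution, of "t * (x \<bullet> a)"]
    by (simp add: f_def char_def mult_ac)
  ultimately have "(CLINT z|?N. of_real (\<Prod>b\<in>Basis. 2 / (1 + (t * z)\<^sup>2 * (a \<bullet> b)\<^sup>2))) =
      (CLINT x|lborel. of_real (exp (- l1_norm x) * exp (- (t * (x \<bullet> a))\<^sup>2 / 2)))"
    by (simp only:)
  then show ?thesis unfolding integral_complex_of_real of_real_eq_iff by simp
qed

text \<open>The hypothesis is applied at s = (t z)^2 for each z, which is why it must hold for all s
  \<ge> 0; taking reciprocals reverses it. The conclusion is in nonnegative integrals because the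
  comparison with volumes takes place in \<open>ennreal\<close>.\<close>

lemma nn_integral_laplace_gaussian_mono:
  fixes a a' :: "'a::euclidean_space" and t :: real
  assumes le: "\<And>s. 0 \<le> s \<Longrightarrow> (\<Prod>b\<in>Basis. 1 + s * (a \<bullet> b)\<^sup>2) \<le> (\<Prod>b\<in>Basis. 1 + s * (a' \<bullet> b)\<^sup>2)"
  shows "(\<integral>\<^sup>+x. ennreal (exp (- l1_norm x) * exp (- (t * (x \<bullet> a'))\<^sup>2 / 2)) \<partial>lborel) \<le>
    (\<integral>\<^sup>+x. ennreal (exp (- l1_norm x) * exp (- (t * (x \<bullet> a))\<^sup>2 / 2)) \<partial>lborel)"
proof -
  let ?N = std_normal_distribution
  interpret N: real_distribution ?N by (rule real_dist_normal_dist)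
  let ?h = "\<lambda>(a::'a) z. \<Prod>b\<in>Basis. 2 / (1 + (t * z)\<^sup>2 * (a \<bullet> b)\<^sup>2)"
  let ?J = "\<lambda>(a::'a) x. exp (- l1_norm x) * exp (- (t * (x \<bullet> a))\<^sup>2 / 2)"
  have J: "integrable lborel (?J a)" for a
    by (rule Bochner_Integration.integrable_bound[OF integrable_exp_minus_l1_norm])
      (auto simp: mult_le_cancel_left1)
  have h: "integrable ?N (?h a)" for a
  proof (rule N.integrable_const_bound)
    show "AE z in ?N. norm (?h a z) \<le> (\<Prod>b\<in>(Basis::'a set). 2)"
    proof (intro AE_I2, unfold real_norm_def abs_prod, intro prod_mono conjI)
      fix z and b :: 'a
      have "\<bar>2 / (1 + w)\<bar> \<le> 2" if "0 \<le> w" for w :: real using that by (simp add: field_simps)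
      then show "\<bar>2 / (1 + (t * z)\<^sup>2 * (a \<bullet> b)\<^sup>2)\<bar> \<le> 2" by simp
    qed simp
  qed simp
  have "?h a' z \<le> ?h a z" for z
  proof -
    have "0 < (\<Prod>b\<in>Basis. 1 + (t * z)\<^sup>2 * (a \<bullet> b)\<^sup>2)"
      by (intro prod_pos) (auto intro: add_pos_nonneg)
    with le[of "(t * z)\<^sup>2"] show ?thesis
      unfolding prod_dividef by (intro divide_left_mono mult_pos_pos) auto
  qed
  then have "(LINT z|?N. ?h a' z) \<le> (LINT z|?N. ?h a z)"
    by (intro integral_mono h) auto
  then have "(LINT x|lborel. ?J a' x) \<le> (LINT x|lborel. ?J a x)"
    unfolding integral_laplace_gaussian .
  then show ?thesis
    by (subst (1 2) nn_integral_eq_integral[OF J]) (auto intro: ennreal_leI)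
qed

section \<open>Volume of hyperplane sections\<close>

lemma orthonormal_basis_insert_normal:
  fixes a :: "real ^ 'n"
  assumes B: "orthonormal_basis B (hyperplane_orth a)" and a: "norm a = 1"
  shows "orthonormal_basis (insert a B) UNIV" "a \<notin> B"
proof -
  have aa: "a \<bullet> a = 1" using a by (simp add: norm_eq_1)
  have B': "B \<subseteq> hyperplane_orth a" "pairwise orthogonal B" "\<forall>b\<in>B. norm b = 1"
    "span B = hyperplane_orth a"
    using B by (auto simp: orthonormal_basis_def)
  show "a \<notin> B" using B'(1) aa by (auto simp: hyperplane_orth_def)
  have "pairwise orthogonal (insert a B)"
    using B'(1,2) by (auto simp: pairwise_insert orthogonal_def hyperplane_orth_def inner_commute)
  moreover have "x \<in> span (insert a B)" for x
  proof -
    have "x - (x \<bullet> a) *\<^sub>R a \<in> span B"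
      unfolding B'(4) using aa by (simp add: hyperplane_orth_def inner_diff_left)
    then show ?thesis by (auto simp: span_insert)
  qed
  ultimately show "orthonormal_basis (insert a B) UNIV"
    using B'(3) a by (auto simp: orthonormal_basis_def)
qed

text \<open>Fubini in the orthonormal coordinates formed by \<open>B\<close> and the normal
  \<open>a\<close>; rotation invariance of Lebesgue measure enters through
  \<open>distr_orthonormal_basis_UNIV\<close>.\<close>

lemma nn_integral_lborel_hyperplane_slices:
  fixes a :: "real ^ 'n::{finite,wellorder}"
  assumes B: "orthonormal_basis B (hyperplane_orth a)" and a: "norm a = 1"
    and F [measurable]: "F \<in> borel_measurable borel"
  shows "(\<integral>\<^sup>+x. F x \<partial>lborel) =
    (\<integral>\<^sup>+c. \<integral>\<^sup>+y. F ((\<Sum>b\<in>B. c b *\<^sub>R b) + y *\<^sub>R a) \<partial>lborel \<partial>(\<Pi>\<^sub>M b\<in>B. lborel))"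
proof -
  interpret product_sigma_finite "\<lambda>_::real^'n::_. lborel :: real measure" by standard
  note E = orthonormal_basis_insert_normal[OF B a]
  have fin: "finite B" using orthonormal_basis_independent B by auto
  let ?S = "\<lambda>c. \<Sum>b\<in>insert a B. c b *\<^sub>R b"
  have "(\<integral>\<^sup>+x. F x \<partial>lborel) = (\<integral>\<^sup>+x. F x \<partial>distr (\<Pi>\<^sub>M b\<in>insert a B. lborel) borel ?S)"
    unfolding distr_orthonormal_basis_UNIV[OF E(1)] ..
  also have "\<dots> = (\<integral>\<^sup>+c. F (?S c) \<partial>(\<Pi>\<^sub>M b\<in>insert a B. lborel))"
    by (intro nn_integral_distr) auto
  also have "\<dots> = (\<integral>\<^sup>+c. \<integral>\<^sup>+y. F (?S (c(a := y))) \<partial>lborel \<partial>(\<Pi>\<^sub>M b\<in>B. lborel))"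
    using fin E(2) by (intro product_nn_integral_insert) auto
  also have "\<dots> = (\<integral>\<^sup>+c. \<integral>\<^sup>+y. F ((\<Sum>b\<in>B. c b *\<^sub>R b) + y *\<^sub>R a) \<partial>lborel \<partial>(\<Pi>\<^sub>M b\<in>B. lborel))"
  proof (intro nn_integral_cong arg_cong[where f=F])
    fix c y
    have "(\<Sum>b\<in>B. (c(a := y)) b *\<^sub>R b) = (\<Sum>b\<in>B. c b *\<^sub>R b)"
      using E(2) by (intro sum.cong) auto
    then show "?S (c(a := y)) = (\<Sum>b\<in>B. c b *\<^sub>R b) + y *\<^sub>R a" using fin E(2) by simp
  qed
  finally show ?thesis .
qed

lemma sum_orthonormal_basis_hyperplane:
  assumes "orthonormal_basis B (hyperplane_orth a)"
  shows "(\<Sum>b\<in>B. c b *\<^sub>R b) \<bullet> a = 0"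
  using assms by (auto simp: orthonormal_basis_def hyperplane_orth_def inner_sum_left intro!: sum.neutral)

lemma
  fixes x :: "real ^ 'n"
  shows prod_Basis_vec: "(\<Prod>b\<in>Basis. g (x \<bullet> b)) = (\<Prod>i\<in>UNIV. g (x $ i))"
    and sum_Basis_vec: "(\<Sum>b\<in>Basis. h (x \<bullet> b)) = (\<Sum>i\<in>UNIV. h (x $ i))"
proof -
  have B: "(Basis :: (real ^ 'n) set) = range (\<lambda>i. axis i 1)" by (auto simp: Basis_vec_def)
  have i: "inj (\<lambda>i :: 'n. axis i (1 :: real))" by (auto simp: inj_on_def axis_eq_axis)
  show "(\<Prod>b\<in>Basis. g (x \<bullet> b)) = (\<Prod>i\<in>UNIV. g (x $ i))"
    unfolding B by (subst prod.reindex[OF i]) (simp add: inner_axis)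
  show "(\<Sum>b\<in>Basis. h (x \<bullet> b)) = (\<Sum>i\<in>UNIV. h (x $ i))"
    unfolding B by (subst sum.reindex[OF i]) (simp add: inner_axis)
qed

lemma card_orthonormal_basis_hyperplane:
  fixes a :: "real ^ 'n"
  assumes "orthonormal_basis B (hyperplane_orth a)" and "norm a = 1"
  shows "CARD('n) = Suc (card B)"
proof -
  note E = orthonormal_basis_insert_normal[OF assms]
  have "card (insert a B) = CARD('n)"
    using E(1) dim_eq_card_independent[OF orthonormal_basis_independent(1)[OF E(1)]]
    unfolding orthonormal_basis_def by (metis dim_UNIV dim_span DIM_cart DIM_real mult_1_right)
  then show ?thesis
    using E(2) orthonormal_basis_independent(2)[OF assms(1)] by simp
qed

(* Both sides are computed from the volume of the slab 0 \<le> x \<bullet> a \<le> u over the section of radius u,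
   since Lebesgue measure on the whole space is known to scale. *)
lemma hyperplane_l1_ball_scale:
  fixes a :: "real ^ 'n::{finite,wellorder}"
  assumes B: "orthonormal_basis B (hyperplane_orth a)" and a: "norm a = 1" and u: "0 < u"
  shows "(\<integral>\<^sup>+c. indicator {..u} (l1_norm (\<Sum>b\<in>B. c b *\<^sub>R b)) \<partial>(\<Pi>\<^sub>M b\<in>B. lborel)) =
    ennreal (u ^ card B) * (\<integral>\<^sup>+c. indicator {..1} (l1_norm (\<Sum>b\<in>B. c b *\<^sub>R b)) \<partial>(\<Pi>\<^sub>M b\<in>B. lborel))"
proof -
  let ?S = "\<lambda>c. \<Sum>b\<in>B. c b *\<^sub>R b"
  define F where "F r h x = (indicator {..r} (l1_norm (x - (x \<bullet> a) *\<^sub>R a)) * indicator {0..h} (x \<bullet> a) :: ennreal)"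
    for r h :: real and x
  have Fm [measurable]: "F r h \<in> borel_measurable borel" for r h
    unfolding F_def by measurable
  have aa: "a \<bullet> a = 1" using a by (simp add: norm_eq_1)
  have slab: "(\<integral>\<^sup>+x. F r h x \<partial>lborel) =
      ennreal h * (\<integral>\<^sup>+c. indicator {..r} (l1_norm (?S c)) \<partial>(\<Pi>\<^sub>M b\<in>B. lborel))" if "0 \<le> h" for r h
  proof -
    have "(?S c + y *\<^sub>R a) \<bullet> a = y" for c y
      using sum_orthonormal_basis_hyperplane[OF B] aa by (simp add: inner_add_left)
    then have F: "F r h (?S c + y *\<^sub>R a) = indicator {..r} (l1_norm (?S c)) * indicator {0..h} y" for c y
      by (simp add: F_def)
    have "(\<integral>\<^sup>+y. F r h (?S c + y *\<^sub>R a) \<partial>lborel) = ennreal h * indicator {..r} (l1_norm (?S c))" for c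
    proof -
      have "(\<integral>\<^sup>+y. indicator {..r} (l1_norm (?S c)) * indicator {0..h} y \<partial>lborel) =
          indicator {..r} (l1_norm (?S c)) * emeasure lborel {0..h}"
        by (intro nn_integral_cmult_indicator) simp
      then show ?thesis using that by (simp add: F mult.commute)
    qed
    then have "(\<integral>\<^sup>+x. F r h x \<partial>lborel) =
      (\<integral>\<^sup>+c. ennreal h * indicator {..r} (l1_norm (?S c)) \<partial>(\<Pi>\<^sub>M b\<in>B. lborel))"
      unfolding nn_integral_lborel_hyperplane_slices[OF B a Fm] by (rule nn_integral_cong)
    also have "\<dots> = ennreal h * (\<integral>\<^sup>+c. indicator {..r} (l1_norm (?S c)) \<partial>(\<Pi>\<^sub>M b\<in>B. lborel))"
      by (intro nn_integral_cmult) measurable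
    finally show ?thesis .
  qed
  \<comment> \<open>Radius and height of the slab scale together, so the factor u^n of the whole
    space splits into u for the height and \<open>u ^ card B\<close> for the section.\<close>
  have scale: "F u u (u *\<^sub>R x) = F 1 1 x" for x
  proof -
    have "u *\<^sub>R x - ((u *\<^sub>R x) \<bullet> a) *\<^sub>R a = u *\<^sub>R (x - (x \<bullet> a) *\<^sub>R a)"
      by (simp add: scaleR_diff_right)
    then have "l1_norm (u *\<^sub>R x - ((u *\<^sub>R x) \<bullet> a) *\<^sub>R a) = u * l1_norm (x - (x \<bullet> a) *\<^sub>R a)"
      using u by (simp add: l1_norm_scaleR)
    then show ?thesis using u by (simp add: F_def indicator_def zero_le_mult_iff)
  qed
  have "ennreal u * (\<integral>\<^sup>+c. indicator {..u} (l1_norm (?S c)) \<partial>(\<Pi>\<^sub>M b\<in>B. lborel)) = (\<integral>\<^sup>+x. F u u x \<partial>lborel)"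
    using slab u by simp
  also have "\<dots> = (\<integral>\<^sup>+x. F u u x \<partial>density (distr lborel borel (\<lambda>x. 0 + u *\<^sub>R x)) (\<lambda>_. ennreal (\<bar>u\<bar> ^ DIM(real ^ 'n::_))))"
    using u by (subst lborel_affine[of u 0]) auto
  also have "\<dots> = ennreal (u ^ CARD('n)) * (\<integral>\<^sup>+x. F 1 1 x \<partial>lborel)"
    using u by (simp add: nn_integral_density nn_integral_distr nn_integral_cmult scale)
  also have "\<dots> = ennreal u * (ennreal (u ^ card B) *
      (\<integral>\<^sup>+c. indicator {..1} (l1_norm (?S c)) \<partial>(\<Pi>\<^sub>M b\<in>B. lborel)))"
    using u by (simp add: slab card_orthonormal_basis_hyperplane[OF B a] ennreal_mult mult.assoc)
  finally show ?thesis
    using u by (simp add: ennreal_mult_cancel_left)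
qed

text \<open>Layer-cake formula: exp (- r) is the integral of exp (- u) over u \<ge> r, the section
  of radius u has volume \<open>u ^ card B\<close> times that of radius 1, and the remaining Gamma
  integral is the factorial.\<close>

lemma nn_integral_exp_minus_l1_norm_hyperplane:
  fixes a :: "real ^ 'n::{finite,wellorder}"
  assumes B: "orthonormal_basis B (hyperplane_orth a)" and a: "norm a = 1"
  shows "(\<integral>\<^sup>+c. ennreal (exp (- l1_norm (\<Sum>b\<in>B. c b *\<^sub>R b))) \<partial>(\<Pi>\<^sub>M b\<in>B. lborel)) =
    ennreal (fact (card B)) * section_volume a"
proof -
  interpret product_sigma_finite "\<lambda>_::real^'n::_. lborel :: real measure" by standard
  have fin: "finite B" using orthonormal_basis_independent B by auto
  interpret P: sigma_finite_measure "\<Pi>\<^sub>M b\<in>B. lborel :: real measure" by (rule sigma_finite[OF fin])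
  interpret pair_sigma_finite "\<Pi>\<^sub>M b\<in>B. lborel :: real measure" "lborel :: real measure" ..
  let ?P = "\<Pi>\<^sub>M b\<in>B. lborel :: real measure" and ?S = "\<lambda>c. \<Sum>b\<in>B. c b *\<^sub>R b"
  let ?V = "\<lambda>u. \<integral>\<^sup>+c. indicator {..u} (l1_norm (?S c)) \<partial>?P"
  have V: "?V 1 = section_volume a"
  proof -
    have "closed (cross_polytope :: (real ^ 'n::_) set)" "closed (hyperplane_orth a)"
      unfolding cross_polytope_def hyperplane_orth_def
      by (intro closed_Collect_le closed_Collect_eq continuous_intros)+
    then have m: "cross_polytope \<inter> hyperplane_orth a \<in> sets borel" by auto
    have "section_volume a = emeasure ?P (?S -` (cross_polytope \<inter> hyperplane_orth a) \<inter> space ?P)"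
      unfolding section_volume_def lborel_on_eq[OF B] using m by (intro emeasure_distr) auto
    also have "\<dots> = (\<integral>\<^sup>+c. indicator (?S -` (cross_polytope \<inter> hyperplane_orth a) \<inter> space ?P) c \<partial>?P)"
      using m by (intro nn_integral_indicator[symmetric] measurable_sets) auto
    also have "\<dots> = ?V 1"
    proof (intro nn_integral_cong)
      fix c assume "c \<in> space ?P"
      then have "?S c \<in> cross_polytope \<inter> hyperplane_orth a \<longleftrightarrow> l1_norm (?S c) \<le> 1"
        using sum_orthonormal_basis_hyperplane[OF B]
        unfolding l1_norm_def sum_Basis_vec by (simp add: cross_polytope_def hyperplane_orth_def)
      then show "indicator (?S -` (cross_polytope \<inter> hyperplane_orth a) \<inter> space ?P) c =
        (indicator {..1} (l1_norm (?S c)) :: ennreal)"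
        using \<open>c \<in> space ?P\<close> by (simp add: indicator_def)
    qed
    finally show ?thesis ..
  qed
  have e: "ennreal (exp (- r)) = (\<integral>\<^sup>+u. ennreal (exp (- u)) * indicator {..u} r \<partial>lborel)" for r :: real
  proof -
    have "((\<lambda>u. - exp (- u)) \<longlongrightarrow> - (0 :: real)) at_top" (is "(?F \<longlongrightarrow> _) _")
      by (intro tendsto_minus filterlim_compose[OF exp_at_bot filterlim_uminus_at_bot_at_top])
    then have lim: "(?F \<longlongrightarrow> 0) at_top" by simp
    have "(\<integral>\<^sup>+u. ennreal (exp (- u)) * indicator {r..} u \<partial>lborel) = 0 - (- exp (- r))"
    proof (rule nn_integral_FTC_atLeast[OF _ _ _ lim])
      show "DERIV ?F u :> exp (- u)" for u by (auto intro!: derivative_eq_intros)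
    qed auto
    moreover have "indicator {..u} r = (indicator {r..} u :: ennreal)" for u by (simp add: indicator_def)
    ultimately show ?thesis by simp
  qed
  have "(\<integral>\<^sup>+c. ennreal (exp (- l1_norm (?S c))) \<partial>?P) =
      (\<integral>\<^sup>+c. \<integral>\<^sup>+u. ennreal (exp (- u)) * indicator {..u} (l1_norm (?S c)) \<partial>lborel \<partial>?P)"
    by (intro nn_integral_cong e)
  also have "\<dots> = (\<integral>\<^sup>+u. \<integral>\<^sup>+c. ennreal (exp (- u)) * indicator {..u} (l1_norm (?S c)) \<partial>?P \<partial>lborel)"
  proof (rule Fubini'[symmetric])
    have "(\<lambda>x. indicator {..snd x} (l1_norm (?S (fst x)))) =
        (\<lambda>x. if l1_norm (?S (fst x)) \<le> snd x then 1 else 0 :: ennreal)"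
      by (simp add: fun_eq_iff indicator_def)
    moreover have "\<dots> \<in> borel_measurable (?P \<Otimes>\<^sub>M lborel)" by measurable
    ultimately have [measurable]:
      "(\<lambda>x. indicator {..snd x} (l1_norm (?S (fst x))) :: ennreal) \<in> borel_measurable (?P \<Otimes>\<^sub>M lborel)"
      by simp
    show "(\<lambda>(c, u). ennreal (exp (- u)) * indicator {..u} (l1_norm (?S c))) \<in> borel_measurable (?P \<Otimes>\<^sub>M lborel)"
      unfolding split_beta by measurable
  qed
  also have "\<dots> = (\<integral>\<^sup>+u. ennreal (exp (- u)) * ?V u \<partial>lborel)"
    by (intro nn_integral_cong nn_integral_cmult) measurable
  also have "\<dots> = (\<integral>\<^sup>+u. ennreal (u ^ card B * exp (- u)) * indicator {0..} u * ?V 1 \<partial>lborel)"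
  proof (intro nn_integral_cong_AE)
    \<comment> \<open>The scaling law is available for u > 0, and both sides vanish for u < 0; the
      point 0 is discarded as a null set.\<close>
    have "AE u in lborel. u \<noteq> (0 :: real)" by (rule AE_lborel_singleton)
    then show "AE u in lborel. ennreal (exp (- u)) * ?V u =
        ennreal (u ^ card B * exp (- u)) * indicator {0..} u * ?V 1"
    proof eventually_elim
      case (elim u)
      show ?case
      proof (cases "0 < u")
        case True
        then show ?thesis
          unfolding hyperplane_l1_ball_scale[OF B a True] by (simp add: ennreal_mult mult_ac)
      next
        case False
        with elim have "u < 0" by simp
        then have "indicator {..u} (l1_norm x) = (0 :: ennreal)" for x :: "real ^ 'n::_"
          using l1_norm_nonneg[of x] by (simp add: indicator_def)
        then show ?thesis using \<open>u < 0\<close> by simp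
      qed
    qed
  qed
  also have "\<dots> = ennreal (fact (card B)) * ?V 1"
    by (subst nn_integral_multc) (simp_all add: nn_intergal_power_times_exp_Ici)
  finally show ?thesis unfolding V .
qed

section \<open>Gaussian concentration on the hyperplane\<close>

text \<open>The term c |z| is the error from replacing the l1 norm on a parallel slice by its value
  on the hyperplane; dividing c by \<open>Suc k\<close> corresponds to t = k + 1.\<close>

lemma
  fixes c :: real
  shows nn_integral_exp_abs_gaussian_finite:
      "(\<integral>\<^sup>+z. ennreal (exp (c * \<bar>z\<bar> - z\<^sup>2 / 2)) \<partial>lborel) < \<infinity>"
    and nn_integral_exp_abs_gaussian_tendsto:
      "(\<lambda>k. \<integral>\<^sup>+z. ennreal (exp (c / real (Suc k) * \<bar>z\<bar> - z\<^sup>2 / 2)) \<partial>lborel)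
        \<longlonglongrightarrow> (\<integral>\<^sup>+z. ennreal (exp (- z\<^sup>2 / 2)) \<partial>lborel)"
proof -
  have fin: "(\<integral>\<^sup>+z. ennreal (exp (c * \<bar>z\<bar> - z\<^sup>2 / 2)) \<partial>lborel) < \<infinity>" for c :: real
  proof -
    let ?C = "exp (c\<^sup>2) * sqrt (2 * pi * (sqrt 2)\<^sup>2)"
    have "exp (c * \<bar>z\<bar> - z\<^sup>2 / 2) \<le> ?C * normal_density 0 (sqrt 2) z" for z
    proof -
      \<comment> \<open>Completing the square leaves exp (- z^2 / 4), a Gaussian of variance 2; this
        explains \<open>sqrt 2\<close> and the constant \<open>?C\<close>.\<close>
      have "0 \<le> (c - \<bar>z\<bar> / 2)\<^sup>2" by simp
      then have "c * \<bar>z\<bar> - z\<^sup>2 / 2 \<le> c\<^sup>2 - z\<^sup>2 / 4" by (simp add: power2_diff power_divide)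
      then show ?thesis by (simp add: normal_density_def exp_add[symmetric])
    qed
    then have "(\<integral>\<^sup>+z. ennreal (exp (c * \<bar>z\<bar> - z\<^sup>2 / 2)) \<partial>lborel) \<le>
        (\<integral>\<^sup>+z. ennreal (?C * normal_density 0 (sqrt 2) z) \<partial>lborel)"
      by (intro nn_integral_mono ennreal_leI)
    also have "\<dots> < \<infinity>"
      using integrable_normal_density[of "sqrt 2" 0]
      by (subst nn_integral_eq_integral) auto
    finally show ?thesis .
  qed
  then show "(\<integral>\<^sup>+z. ennreal (exp (c * \<bar>z\<bar> - z\<^sup>2 / 2)) \<partial>lborel) < \<infinity>" .
  show "(\<lambda>k. \<integral>\<^sup>+z. ennreal (exp (c / real (Suc k) * \<bar>z\<bar> - z\<^sup>2 / 2)) \<partial>lborel)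
        \<longlonglongrightarrow> (\<integral>\<^sup>+z. ennreal (exp (- z\<^sup>2 / 2)) \<partial>lborel)"
  proof (rule nn_integral_dominated_convergence[where w = "\<lambda>z. ennreal (exp (\<bar>c\<bar> * \<bar>z\<bar> - z\<^sup>2 / 2))"])
    show "AE z in lborel. ennreal (exp (c / real (Suc k) * \<bar>z\<bar> - z\<^sup>2 / 2)) \<le> ennreal (exp (\<bar>c\<bar> * \<bar>z\<bar> - z\<^sup>2 / 2))" for k
    proof (intro AE_I2 ennreal_leI)
      fix z :: real
      have "c / real (Suc k) \<le> \<bar>c\<bar> / real (Suc k)" by (intro divide_right_mono) auto
      also have "\<dots> \<le> \<bar>c\<bar> / 1" by (intro divide_left_mono) auto
      finally have "c / real (Suc k) * \<bar>z\<bar> \<le> \<bar>c\<bar> / 1 * \<bar>z\<bar>" by (rule mult_right_mono) simp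
      then show "exp (c / real (Suc k) * \<bar>z\<bar> - z\<^sup>2 / 2) \<le> exp (\<bar>c\<bar> * \<bar>z\<bar> - z\<^sup>2 / 2)"
        by simp
    qed
    show "AE z in lborel. (\<lambda>k. ennreal (exp (c / real (Suc k) * \<bar>z\<bar> - z\<^sup>2 / 2))) \<longlonglongrightarrow> ennreal (exp (- z\<^sup>2 / 2))"
    proof (intro AE_I2 tendsto_ennrealI)
      fix z :: real
      have "(\<lambda>k. c / real (Suc k)) \<longlonglongrightarrow> 0" using LIMSEQ_Suc[OF lim_const_over_n[of c]] by simp
      then have "(\<lambda>k. exp (c / real (Suc k) * \<bar>z\<bar> - z\<^sup>2 / 2)) \<longlonglongrightarrow> exp (0 * \<bar>z\<bar> - z\<^sup>2 / 2)"
        by (intro tendsto_intros)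
      then show "(\<lambda>k. exp (c / real (Suc k) * \<bar>z\<bar> - z\<^sup>2 / 2)) \<longlonglongrightarrow> exp (- z\<^sup>2 / 2)" by simp
    qed
  qed (use fin in auto)
qed

text \<open>On the slice at height y the weight exp (- l1 norm) differs from its value at the foot
  point by a factor between exp (- \<open>l1_norm a\<close> |y|) and exp (\<open>l1_norm a\<close>
  |y|). The substitution z = t y produces the factor t and shrinks this error to
  \<open>l1_norm a / t\<close>.\<close>

lemma
  fixes a :: "real ^ 'n::{finite,wellorder}"
  assumes B: "orthonormal_basis B (hyperplane_orth a)" and a: "norm a = 1" and t: "0 < t"
  defines "J \<equiv> (\<integral>\<^sup>+x. ennreal (exp (- l1_norm x) * exp (- (t * (x \<bullet> a))\<^sup>2 / 2)) \<partial>lborel)"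
    and "G \<equiv> (\<integral>\<^sup>+c. ennreal (exp (- l1_norm (\<Sum>b\<in>B. c b *\<^sub>R b))) \<partial>(\<Pi>\<^sub>M b\<in>B. lborel))"
  shows laplace_gaussian_upper:
      "ennreal t * J \<le> G * (\<integral>\<^sup>+z. ennreal (exp (l1_norm a / t * \<bar>z\<bar> - z\<^sup>2 / 2)) \<partial>lborel)"
    and laplace_gaussian_lower:
      "G * (\<integral>\<^sup>+z. ennreal (exp (- l1_norm a / t * \<bar>z\<bar> - z\<^sup>2 / 2)) \<partial>lborel) \<le> ennreal t * J"
proof -
  let ?P = "\<Pi>\<^sub>M b\<in>B. lborel :: real measure" and ?S = "\<lambda>c. \<Sum>b\<in>B. c b *\<^sub>R b"
  have aa: "a \<bullet> a = 1" using a by (simp add: norm_eq_1)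
  have in_a: "(?S c + y *\<^sub>R a) \<bullet> a = y" for c y
    using sum_orthonormal_basis_hyperplane[OF B] aa by (simp add: inner_add_left)
  have J: "J = (\<integral>\<^sup>+c. \<integral>\<^sup>+y. ennreal (exp (- l1_norm (?S c + y *\<^sub>R a)) * exp (- (t * y)\<^sup>2 / 2)) \<partial>lborel \<partial>?P)"
    unfolding J_def by (subst nn_integral_lborel_hyperplane_slices[OF B a]) (simp_all add: in_a)
  \<comment> \<open>Used with s = 1 for the upper and s = - 1 for the lower bound.\<close>
  have W: "ennreal t * (\<integral>\<^sup>+c. \<integral>\<^sup>+y. ennreal (exp (- l1_norm (?S c)) * exp (s * l1_norm a * \<bar>y\<bar> - (t * y)\<^sup>2 / 2)) \<partial>lborel \<partial>?P) =
     G * (\<integral>\<^sup>+z. ennreal (exp (s * l1_norm a / t * \<bar>z\<bar> - z\<^sup>2 / 2)) \<partial>lborel)" for s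
  proof -
    have "(\<integral>\<^sup>+z. ennreal (exp (s * l1_norm a / t * \<bar>z\<bar> - z\<^sup>2 / 2)) \<partial>lborel) =
      ennreal t * (\<integral>\<^sup>+y. ennreal (exp (s * l1_norm a * \<bar>y\<bar> - (t * y)\<^sup>2 / 2)) \<partial>lborel)"
      using t by (subst nn_integral_real_affine[where c=t and t=0]) (simp_all add: abs_mult mult.assoc)
    then show ?thesis
      unfolding G_def by (simp add: ennreal_mult nn_integral_cmult nn_integral_multc mult_ac)
  qed
  have "J \<le> (\<integral>\<^sup>+c. \<integral>\<^sup>+y. ennreal (exp (- l1_norm (?S c)) * exp (1 * l1_norm a * \<bar>y\<bar> - (t * y)\<^sup>2 / 2)) \<partial>lborel \<partial>?P)"
    unfolding J exp_add[symmetric]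
  proof (intro nn_integral_mono ennreal_leI exp_le_cancel_iff[THEN iffD2])
    fix c y
    show "- l1_norm (?S c + y *\<^sub>R a) + - (t * y)\<^sup>2 / 2 \<le> - l1_norm (?S c) + (1 * l1_norm a * \<bar>y\<bar> - (t * y)\<^sup>2 / 2)"
      using l1_norm_add_scaleR_bounds(2)[of "?S c" a y] by simp
  qed
  from mult_left_mono[OF this, of "ennreal t"]
  show "ennreal t * J \<le> G * (\<integral>\<^sup>+z. ennreal (exp (l1_norm a / t * \<bar>z\<bar> - z\<^sup>2 / 2)) \<partial>lborel)"
    unfolding W by simp
  have "(\<integral>\<^sup>+c. \<integral>\<^sup>+y. ennreal (exp (- l1_norm (?S c)) * exp (- 1 * l1_norm a * \<bar>y\<bar> - (t * y)\<^sup>2 / 2)) \<partial>lborel \<partial>?P) \<le> J"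
    unfolding J exp_add[symmetric]
  proof (intro nn_integral_mono ennreal_leI exp_le_cancel_iff[THEN iffD2])
    fix c y
    show "- l1_norm (?S c) + (- 1 * l1_norm a * \<bar>y\<bar> - (t * y)\<^sup>2 / 2) \<le> - l1_norm (?S c + y *\<^sub>R a) + - (t * y)\<^sup>2 / 2"
      using l1_norm_add_scaleR_bounds(1)[of "?S c" y a] by simp
  qed
  from mult_left_mono[OF this, of "ennreal t"]
  show "G * (\<integral>\<^sup>+z. ennreal (exp (- l1_norm a / t * \<bar>z\<bar> - z\<^sup>2 / 2)) \<partial>lborel) \<le> ennreal t * J"
    unfolding W by simp
qed

text \<open>The lower bound for a', the comparison of expectations and the upper bound for a are
  chained at each t = k + 1; in the limit both sides carry the same Gaussian constant, and then the
  same factorial.\<close>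

lemma section_volume_mono:
  fixes a a' :: "real ^ 'n::{finite,wellorder}"
  assumes a: "norm a = 1" "norm a' = 1"
    and le: "\<And>s. 0 \<le> s \<Longrightarrow> (\<Prod>i\<in>UNIV. 1 + s * (a $ i)\<^sup>2) \<le> (\<Prod>i\<in>UNIV. 1 + s * (a' $ i)\<^sup>2)"
  shows "section_volume a' \<le> section_volume a"
proof -
  have sub: "subspace (hyperplane_orth a)" for a :: "real ^ 'n::_"
    by (simp add: subspace_def hyperplane_orth_def inner_add_left)
  obtain B B' where B: "orthonormal_basis B (hyperplane_orth a)" "orthonormal_basis B' (hyperplane_orth a')"
    using orthonormal_basis_exists[OF sub] by meson
  have card: "card B = card B'"
    using card_orthonormal_basis_hyperplane[OF B(1) a(1)] card_orthonormal_basis_hyperplane[OF B(2) a(2)] by simp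
  define G G' where "G = ennreal (fact (card B)) * section_volume a"
    and "G' = ennreal (fact (card B)) * section_volume a'"
  let ?W = "\<lambda>c. \<integral>\<^sup>+z. ennreal (exp (c * \<bar>z\<bar> - z\<^sup>2 / 2)) \<partial>lborel"
  define N where "N = (\<integral>\<^sup>+z. ennreal (exp (- z\<^sup>2 / 2)) \<partial>lborel)"
  \<comment> \<open>The volumes have not been shown to be finite, so both the limit of the products
    and the cancellation in \<open>ennreal\<close> rely on N being neither 0 nor infinite.\<close>
  have N: "N \<noteq> 0" "N < \<infinity>"
    using nn_integral_exp_abs_gaussian_finite[of 0]
    by (auto simp: N_def nn_integral_0_iff_AE eventually_False ae_filter_eq_bot_iff)
  have le_k: "G' * ?W (- l1_norm a' / real (Suc k)) \<le> G * ?W (l1_norm a / real (Suc k))" for k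
  proof -
    let ?t = "real (Suc k)"
    let ?J = "\<lambda>a :: real ^ 'n::_. ennreal ?t * (\<integral>\<^sup>+x. ennreal (exp (- l1_norm x) * exp (- (?t * (x \<bullet> a))\<^sup>2 / 2)) \<partial>lborel)"
    have "G' * ?W (- l1_norm a' / ?t) \<le> ?J a'"
      using laplace_gaussian_lower[OF B(2) a(2), of ?t]
      unfolding nn_integral_exp_minus_l1_norm_hyperplane[OF B(2) a(2)] G'_def card by simp
    also have "\<dots> \<le> ?J a"
      using le by (intro mult_left_mono nn_integral_laplace_gaussian_mono) (auto simp: prod_Basis_vec[of "\<lambda>x. 1 + s * x\<^sup>2" for s])
    also have "\<dots> \<le> G * ?W (l1_norm a / ?t)"
      using laplace_gaussian_upper[OF B(1) a(1), of ?t]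
      unfolding nn_integral_exp_minus_l1_norm_hyperplane[OF B(1) a(1)] G_def by simp
    finally show ?thesis .
  qed
  have lim: "(\<lambda>k. G' * ?W (- l1_norm a' / real (Suc k))) \<longlonglongrightarrow> G' * N"
    using N nn_integral_exp_abs_gaussian_tendsto[of "- l1_norm a'"]
    unfolding N_def[symmetric] by (intro tendsto_mult_ennreal tendsto_const) auto
  have lim': "(\<lambda>k. G * ?W (l1_norm a / real (Suc k))) \<longlonglongrightarrow> G * N"
    using N nn_integral_exp_abs_gaussian_tendsto[of "l1_norm a"]
    unfolding N_def[symmetric] by (intro tendsto_mult_ennreal tendsto_const) auto
  have "G' * N \<le> G * N" using le_k by (intro LIMSEQ_le[OF lim lim']) auto
  then have "N * G' \<le> N * G" by (simp only: mult.commute)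
  then have "G' \<le> G" using N by (simp add: ennreal_mult_le_mult_iff)
  then show ?thesis by (simp add: G_def G'_def ennreal_mult_le_mult_iff)
qed

section \<open>The minimal section\<close>

lemma norm_unit_zero_sum: "a \<in> unit_zero_sum \<Longrightarrow> norm a = 1"
  by (simp add: unit_zero_sum_def norm_vec_def L2_set_def)

text \<open>One formula for both parities; the even and odd vectors of the theorem are its values at
  k = n / 2 and k = (n - 1) / 2.\<close>

lemma balanced_two_block_is_arg_min:
  fixes n k :: nat
  defines "n \<equiv> CARD('n::{finite,wellorder})"
  assumes n: "2 \<le> n" and k: "k = n div 2"
  shows "is_arg_min section_volume (\<lambda>a. a \<in> unit_zero_sum)
    (two_block k (sqrt (real (n - k) / (real k * real n))) (- sqrt (real k / (real (n - k) * real n))) :: real ^ 'n::_)"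
    (is "is_arg_min _ _ ?a")
proof -
  have kn: "0 < k" "k < CARD('n)" using n k by (auto simp: n_def)
  have mem: "?a \<in> unit_zero_sum"
    unfolding n_def by (rule balanced_two_block_mem[OF kn])
  have "section_volume ?a \<le> section_volume a" if a: "a \<in> unit_zero_sum" for a :: "real ^ 'n::_"
  proof (rule section_volume_mono)
    show "(\<Prod>i\<in>UNIV. 1 + s * (a $ i)\<^sup>2) \<le> (\<Prod>i\<in>UNIV. 1 + s * (?a $ i)\<^sup>2)" if "0 \<le> s" for s
      unfolding n_def balanced_two_block_prod[OF kn]
      by (rule prod_one_plus_square_le_two_block[OF a that n[unfolded n_def] k[unfolded n_def]])
  qed (rule norm_unit_zero_sum[OF a] norm_unit_zero_sum[OF mem])+
  with mem show ?thesis unfolding is_arg_min_def not_less[symmetric] by blast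
qed

theorem theorem5p1:
  fixes n :: nat
  assumes "n = CARD('n::{finite,wellorder})" and "n \<ge> 2"
  shows "(even n \<longrightarrow>
           is_arg_min section_volume (\<lambda>a. a \<in> unit_zero_sum)
             (two_block (n div 2) (1 / sqrt (real n)) (- (1 / sqrt (real n))) :: real ^ 'n::_)) \<and>
         (odd n \<longrightarrow>
           is_arg_min section_volume (\<lambda>a. a \<in> unit_zero_sum)
             (two_block ((n - 1) div 2)
                (sqrt ((real n + 1) / (real n * (real n - 1))))
                (- sqrt ((real n - 1) / (real n * (real n + 1)))) :: real ^ 'n::_))"
proof (intro conjI impI)
  note min = balanced_two_block_is_arg_min[where 'n = 'n, folded assms(1), OF assms(2) refl]
  show "is_arg_min section_volume (\<lambda>a. a \<in> unit_zero_sum)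
      (two_block (n div 2) (1 / sqrt (real n)) (- (1 / sqrt (real n))) :: real ^ 'n::_)" if ev: "even n"
  proof -
    obtain m where m: "n = 2 * m" using ev by blast
    have h: "n div 2 = m" "n - m = m" and "0 < m" using assms(2) unfolding m by auto
    then have c: "sqrt (real m / (real m * real n)) = 1 / sqrt (real n)" by (simp add: real_sqrt_divide)
    show ?thesis using min unfolding h c .
  qed
  show "is_arg_min section_volume (\<lambda>a. a \<in> unit_zero_sum)
      (two_block ((n - 1) div 2)
        (sqrt ((real n + 1) / (real n * (real n - 1))))
        (- sqrt ((real n - 1) / (real n * (real n + 1)))) :: real ^ 'n::_)" if od: "odd n"
  proof -
    obtain m where m: "n = 2 * m + 1" using od oddE by blast
    have h: "n div 2 = m" "(n - 1) div 2 = m" "n - m = m + 1" unfolding m by auto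
    \<comment> \<open>The block sizes are (n - 1) / 2 and (n + 1) / 2; the halves cancel in both
      quotients.\<close>
    have r: "real m = (real n - 1) / 2" "real (m + 1) = (real n + 1) / 2"
      unfolding m by (auto simp: field_simps)
    have half: "x / 2 / (y / 2 * z) = x / (z * y)" for x y z :: real by (simp add: mult.commute)
    have c: "real (m + 1) / (real m * real n) = (real n + 1) / (real n * (real n - 1))"
      "real m / (real (m + 1) * real n) = (real n - 1) / (real n * (real n + 1))"
      unfolding r half by (rule refl)+
    show ?thesis using min unfolding h c .
  qed
qed

end
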